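(* Let $\Delta$ be a locally finite semiregular right-angled building over a finite index set $I$ with a fixed legal coloring $\lambda$, and let $\mathbf F=(F_i)_{i\in I}$, $\acute{\mathbf F}=(\acute F_i)_{i\in I}$ be local data with $F_i\leq\acute F_i\leq\widehat F_i\leq\operatorname{Sym}(\Omega_i)$ for every $i\in I$. Endow $\mathcal G(\mathbf F,\acute{\mathbf F})$ with the unique group topology for which the inclusion $\mathcal U(\mathbf F)\hookrightarrow\mathcal G(\mathbf F,\acute{\mathbf F})$ is continuous and open, where $\mathcal U(\mathbf F)$ carries the permutation topology. Then $\mathcal G(\mathbf F,\acute{\mathbf F})$ is a totally disconnected locally compact group.
   Context: Let $I$ be a finite set and $M=(m_{ij})_{i,j\in I}$ a right-angled Coxeter matrix: $m_{ii}=1$ and $m_{ij}\in\{2,\infty\}$ for $i\neq j$. $\Delta$ is a semiregular right-angled building of type $M$ with parameters $(q_i)_{i\in I}$ (each $i$-panel, i.e. residue of type $\{i\}$, has exactly $q_i$ chambers); it is identified with its set of chambers. Locally finite: all $q_i$ are finite. $\operatorname{Aut}(\Delta)$ is the group of type-preserving automorphisms. The permutation topology on $\operatorname{Aut}(\Delta)$ and its subgroups has as identity neighborhood basis the pointwise stabilizers of finite sets of chambers. Legal coloring: for each $i$ let $\Omega_i$ be a set of cardinality $q_i$; a legal coloring is a map $\lambda=(\lambda_i)_{i\in I}\colon\Delta\to\prod_{i\in I}\Omega_i$ such that for each $i$-panel $\mathcal P$ the restriction $\lambda_i|_{\mathcal P}\colon \mathcal P\to\Omega_i$ is a bijection and $\lambda_j|_{\mathcal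 P}$ is constant for every $j\neq i$. The local action of $g\in\operatorname{Aut}(\Delta)$ at an $i$-panel $\mathcal P$ is $\sigma_\lambda(g,\mathcal P)=\lambda_i|_{g\mathcal P}\circ g|_{\mathcal P}\circ(\lambda_i|_{\mathcal P})^{-1}\in\operatorname{Sym}(\Omega_i)$. Local data $\mathbf F$: a family of permutation groups $F_i\leq\operatorname{Sym}(\Omega_i)$, $i\in I$. $\widehat F_i$ is the Young overgroup of $F_i$: the group of all permutations of $\Omega_i$ stabilizing each $F_i$-orbit. $\mathcal U(\mathbf F)$ is the group of $g\in\operatorname{Aut}(\Delta)$ with $\sigma_\lambda(g,\mathcal P)\in F_i$ for all $i$ and all $i$-panels $\mathcal P$ (similarly $\mathcal U(\acute{\mathbf F})$). $\mathcal G(\mathbf F)$ is the group of $g\in\operatorname{Aut}(\Delta)$ such that for every $i\in I$, $\sigma_\lambda(g,\mathcal P)\in F_i$ for all but finitely many $i$-panels $\mathcal P$. $\mathcal G(\mathbf F,\acute{\mathbf F})=\mathcal G(\mathbf F)\cap\mathcal U(\acute{\mathbf F})$. Topology: a basis of identity neighborhoods for the topology on $\mathcal G(\mathbf F,\acute{\mathbf F})$ is given by the pointwise stabilizers in $\mathcal U(\mathbf F)$ of finite sets of chambers; existence and uniqueness of this group topology is a known general fact (since $\mathcal U(\mathbf F)$ is closed in $\operatorname{Aut}(\Delta)$). *)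

theory Defs
  imports "HOL-Analysis.Analysis" "HOL-Library.Extended_Nat"
    "HOL-Algebra.Bij" "HOL-Algebra.Coset" "HOL-Algebra.Group_Action"
begin

section \<open>Coxeter matrices and Coxeter groups\<close>

definition coxeter_matrix :: "'i set \<Rightarrow> ('i \<Rightarrow> 'i \<Rightarrow> enat) \<Rightarrow> bool" where
  "coxeter_matrix I m \<longleftrightarrow>
     (\<forall>i\<in>I. m i i = 1) \<and>
     (\<forall>i\<in>I. \<forall>j\<in>I. m i j = m j i) \<and>
     (\<forall>i\<in>I. \<forall>j\<in>I. i \<noteq> j \<longrightarrow> 2 \<le> m i j)"

definition right_angled :: "'i set \<Rightarrow> ('i \<Rightarrow> 'i \<Rightarrow> enat) \<Rightarrow> bool" where
  "right_angled I m \<longleftrightarrow>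
     coxeter_matrix I m \<and> (\<forall>i\<in>I. \<forall>j\<in>I. i \<noteq> j \<longrightarrow> m i j = 2 \<or> m i j = \<infinity>)"

text \<open>
  The Coxeter group \<open>W = \<langle>I | (ij)\<^sup>m\<^sup>(\<^sup>i\<^sup>,\<^sup>j\<^sup>) = 1 for m(i,j) \<noteq> \<infinity>\<rangle>\<close> is represented as the
  quotient of the free monoid \<open>lists I\<close> by the congruence generated by the relators.
  Since \<open>m i i = 1\<close>, every generator is its own inverse (case \<open>i = j\<close>), so the monoid
  presentation and the group presentation define the same group.
\<close>

inductive_set coxeter_rel :: "'i set \<Rightarrow> ('i \<Rightarrow> 'i \<Rightarrow> enat) \<Rightarrow> ('i list \<times> 'i list) set"
  for I :: "'i set" and m :: "'i \<Rightarrow> 'i \<Rightarrow> enat" where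
  refl: "u \<in> lists I \<Longrightarrow> (u, u) \<in> coxeter_rel I m"
| sym: "(u, v) \<in> coxeter_rel I m \<Longrightarrow> (v, u) \<in> coxeter_rel I m"
| trans: "(u, v) \<in> coxeter_rel I m \<Longrightarrow> (v, w) \<in> coxeter_rel I m \<Longrightarrow> (u, w) \<in> coxeter_rel I m"
| relator: "u \<in> lists I \<Longrightarrow> v \<in> lists I \<Longrightarrow> i \<in> I \<Longrightarrow> j \<in> I \<Longrightarrow> m i j = enat k \<Longrightarrow>
    (u @ concat (replicate k [i, j]) @ v, u @ v) \<in> coxeter_rel I m"

definition coxeter_group :: "'i set \<Rightarrow> ('i \<Rightarrow> 'i \<Rightarrow> enat) \<Rightarrow> 'i list set monoid" where
  "coxeter_group I m =
     \<lparr>carrier = lists I // coxeter_rel I m,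
      mult = \<lambda>A B. coxeter_rel I m `` {u @ v | u v. u \<in> A \<and> v \<in> B},
      one = coxeter_rel I m `` {[]}\<rparr>"

definition reduced_word :: "'i set \<Rightarrow> ('i \<Rightarrow> 'i \<Rightarrow> enat) \<Rightarrow> 'i list \<Rightarrow> bool" where
  "reduced_word I m f \<longleftrightarrow>
     f \<in> lists I \<and> (\<forall>g. (f, g) \<in> coxeter_rel I m \<longrightarrow> length f \<le> length g)"


section \<open>Buildings as chamber systems\<close>

text \<open>
  A chamber system over \<open>I\<close> is a set \<open>\<Delta>\<close> of chambers with an equivalence relation \<open>E i\<close>
  for each \<open>i \<in> I\<close>; the \<open>i\<close>-panels are the classes \<open>\<Delta> // E i\<close>.
\<close>

definition chamber_system :: "'i set \<Rightarrow> 'c set \<Rightarrow> ('i \<Rightarrow> ('c \<times> 'c) set) \<Rightarrow> bool" where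
  "chamber_system I \<Delta> E \<longleftrightarrow> \<Delta> \<noteq> {} \<and> (\<forall>i\<in>I. equiv \<Delta> (E i))"

text \<open>Galleries do not stutter: consecutive chambers are distinct.\<close>

fun joined_by_gallery :: "('i \<Rightarrow> ('c \<times> 'c) set) \<Rightarrow> 'i list \<Rightarrow> 'c \<Rightarrow> 'c \<Rightarrow> bool" where
  "joined_by_gallery E [] x y \<longleftrightarrow> x = y"
| "joined_by_gallery E (i # f) x y \<longleftrightarrow>
     (\<exists>z. (x, z) \<in> E i \<and> x \<noteq> z \<and> joined_by_gallery E f z y)"

text \<open>
  Tits' definition: every panel has at least two chambers, and there is a \<open>W\<close>-valued
  distance \<open>\<delta>\<close> such that, for reduced words \<open>f\<close>, \<open>\<delta> x y\<close> is the element of \<open>W\<close>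
  represented by \<open>f\<close> iff \<open>x\<close> and \<open>y\<close> are joined by a gallery of type \<open>f\<close>.
\<close>

definition building ::
  "'i set \<Rightarrow> ('i \<Rightarrow> 'i \<Rightarrow> enat) \<Rightarrow> 'c set \<Rightarrow> ('i \<Rightarrow> ('c \<times> 'c) set) \<Rightarrow> bool" where
  "building I m \<Delta> E \<longleftrightarrow>
     chamber_system I \<Delta> E \<and>
     (\<forall>i\<in>I. \<forall>P \<in> \<Delta> // E i. \<exists>x\<in>P. \<exists>y\<in>P. x \<noteq> y) \<and>
     (\<exists>\<delta> :: 'c \<Rightarrow> 'c \<Rightarrow> 'i list set.
        (\<forall>x\<in>\<Delta>. \<forall>y\<in>\<Delta>. \<delta> x y \<in> carrier (coxeter_group I m)) \<and>
        (\<forall>f. reduced_word I m f \<longrightarrow>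
          (\<forall>x\<in>\<Delta>. \<forall>y\<in>\<Delta>. \<delta> x y = coxeter_rel I m `` {f} \<longleftrightarrow> joined_by_gallery E f x y)))"

text \<open>The parameters are natural numbers, so this includes local finiteness.\<close>

definition locally_finite_semiregular ::
  "'i set \<Rightarrow> 'c set \<Rightarrow> ('i \<Rightarrow> ('c \<times> 'c) set) \<Rightarrow> ('i \<Rightarrow> nat) \<Rightarrow> bool" where
  "locally_finite_semiregular I \<Delta> E q \<longleftrightarrow>
     (\<forall>i\<in>I. \<forall>P \<in> \<Delta> // E i. finite P \<and> card P = q i)"

text \<open>Elements of \<^const>\<open>Bij\<close> are extensional, i.e. \<open>undefined\<close> outside \<open>\<Delta>\<close>.\<close>

definition building_aut :: "'i set \<Rightarrow> 'c set \<Rightarrow> ('i \<Rightarrow> ('c \<times> 'c) set) \<Rightarrow> ('c \<Rightarrow> 'c) set" where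
  "building_aut I \<Delta> E =
     {g \<in> Bij \<Delta>. \<forall>i\<in>I. \<forall>x\<in>\<Delta>. \<forall>y\<in>\<Delta>. (x, y) \<in> E i \<longleftrightarrow> (g x, g y) \<in> E i}"


section \<open>Legal colorings and universal groups\<close>

definition legal_coloring ::
  "'i set \<Rightarrow> 'c set \<Rightarrow> ('i \<Rightarrow> ('c \<times> 'c) set) \<Rightarrow> ('i \<Rightarrow> 'a set) \<Rightarrow> ('i \<Rightarrow> 'c \<Rightarrow> 'a) \<Rightarrow> bool" where
  "legal_coloring I \<Delta> E \<Omega> col \<longleftrightarrow>
     (\<forall>i\<in>I. col i \<in> \<Delta> \<rightarrow> \<Omega> i) \<and>
     (\<forall>i\<in>I. \<forall>P \<in> \<Delta> // E i.
        bij_betw (col i) P (\<Omega> i) \<and>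
        (\<forall>j \<in> I - {i}. \<forall>x\<in>P. \<forall>y\<in>P. col j x = col j y))"

definition local_action ::
  "('i \<Rightarrow> 'a set) \<Rightarrow> ('i \<Rightarrow> 'c \<Rightarrow> 'a) \<Rightarrow> 'i \<Rightarrow> ('c \<Rightarrow> 'c) \<Rightarrow> 'c set \<Rightarrow> 'a \<Rightarrow> 'a" where
  "local_action \<Omega> col i g P = (\<lambda>\<omega> \<in> \<Omega> i. col i (g (inv_into P (col i) \<omega>)))"

definition local_data :: "'i set \<Rightarrow> ('i \<Rightarrow> 'a set) \<Rightarrow> ('i \<Rightarrow> ('a \<Rightarrow> 'a) set) \<Rightarrow> bool" where
  "local_data I \<Omega> F \<longleftrightarrow> (\<forall>i\<in>I. subgroup (F i) (BijGroup (\<Omega> i)))"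

definition young_overgroup :: "'a set \<Rightarrow> ('a \<Rightarrow> 'a) set \<Rightarrow> ('a \<Rightarrow> 'a) set" where
  "young_overgroup X H =
     {s \<in> Bij X. \<forall>B \<in> orbits (BijGroup X\<lparr>carrier := H\<rparr>) X (\<lambda>h. h). s ` B = B}"

definition universal_group ::
  "'i set \<Rightarrow> 'c set \<Rightarrow> ('i \<Rightarrow> ('c \<times> 'c) set) \<Rightarrow> ('i \<Rightarrow> 'a set) \<Rightarrow> ('i \<Rightarrow> 'c \<Rightarrow> 'a) \<Rightarrow>
   ('i \<Rightarrow> ('a \<Rightarrow> 'a) set) \<Rightarrow> ('c \<Rightarrow> 'c) set" where
  "universal_group I \<Delta> E \<Omega> col F =
     {g \<in> building_aut I \<Delta> E. \<forall>i\<in>I. \<forall>P \<in> \<Delta> // E i. local_action \<Omega> col i g P \<in> F i}"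

definition almost_universal_group ::
  "'i set \<Rightarrow> 'c set \<Rightarrow> ('i \<Rightarrow> ('c \<times> 'c) set) \<Rightarrow> ('i \<Rightarrow> 'a set) \<Rightarrow> ('i \<Rightarrow> 'c \<Rightarrow> 'a) \<Rightarrow>
   ('i \<Rightarrow> ('a \<Rightarrow> 'a) set) \<Rightarrow> ('c \<Rightarrow> 'c) set" where
  "almost_universal_group I \<Delta> E \<Omega> col F =
     {g \<in> building_aut I \<Delta> E. \<forall>i\<in>I. finite {P \<in> \<Delta> // E i. local_action \<Omega> col i g P \<notin> F i}}"

definition restricted_universal_group ::
  "'i set \<Rightarrow> 'c set \<Rightarrow> ('i \<Rightarrow> ('c \<times> 'c) set) \<Rightarrow> ('i \<Rightarrow> 'a set) \<Rightarrow> ('i \<Rightarrow> 'c \<Rightarrow> 'a) \<Rightarrow>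
   ('i \<Rightarrow> ('a \<Rightarrow> 'a) set) \<Rightarrow> ('i \<Rightarrow> ('a \<Rightarrow> 'a) set) \<Rightarrow> ('c \<Rightarrow> 'c) monoid" where
  "restricted_universal_group I \<Delta> E \<Omega> col F F' =
     BijGroup \<Delta>\<lparr>carrier :=
       almost_universal_group I \<Delta> E \<Omega> col F \<inter> universal_group I \<Delta> E \<Omega> col F'\<rparr>"


section \<open>Topologies\<close>

definition topological_group :: "('g, 'r) monoid_scheme \<Rightarrow> 'g topology \<Rightarrow> bool" where
  "topological_group G T \<longleftrightarrow>
     group G \<and> topspace T = carrier G \<and>
     continuous_map (prod_topology T T) T (\<lambda>(x, y). x \<otimes>\<^bsub>G\<^esub> y) \<and>
     continuous_map T T (\<lambda>x. inv\<^bsub>G\<^esub> x)"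

definition totally_disconnected_space :: "'x topology \<Rightarrow> bool" where
  "totally_disconnected_space T \<longleftrightarrow>
     (\<forall>x \<in> topspace T. connected_component_of_set T x = {x})"

text \<open>As usual, locally compact groups are Hausdorff by convention.\<close>

definition tdlc_group :: "('g, 'r) monoid_scheme \<Rightarrow> 'g topology \<Rightarrow> bool" where
  "tdlc_group G T \<longleftrightarrow>
     topological_group G T \<and> Hausdorff_space T \<and>
     locally_compact_space T \<and> totally_disconnected_space T"

definition pointwise_stabilizer :: "('c \<Rightarrow> 'c) set \<Rightarrow> 'c set \<Rightarrow> ('c \<Rightarrow> 'c) set" where
  "pointwise_stabilizer H S = {h \<in> H. \<forall>x\<in>S. h x = x}"

text \<open>
  The permutation topology on a subgroup \<open>H\<close> of \<open>BijGroup \<Delta>\<close>: the left translates of the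
  pointwise stabilizers in \<open>H\<close> of finite sets of chambers form a basis.
\<close>

definition permutation_topology :: "'c set \<Rightarrow> ('c \<Rightarrow> 'c) set \<Rightarrow> ('c \<Rightarrow> 'c) topology" where
  "permutation_topology \<Delta> H = topology (\<lambda>U. U \<subseteq> H \<and>
     (\<forall>g\<in>U. \<exists>S. finite S \<and> S \<subseteq> \<Delta> \<and>
        g <#\<^bsub>BijGroup \<Delta>\<^esub> pointwise_stabilizer H S \<subseteq> U))"

lemma openin_permutation_topology:
  "openin (permutation_topology \<Delta> H) U \<longleftrightarrow> U \<subseteq> H \<and>
     (\<forall>g\<in>U. \<exists>S. finite S \<and> S \<subseteq> \<Delta> \<and>
        g <#\<^bsub>BijGroup \<Delta>\<^esub> pointwise_stabilizer H S \<subseteq> U)"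
proof -
  let ?P = "\<lambda>U. U \<subseteq> H \<and> (\<forall>g\<in>U. \<exists>S. finite S \<and> S \<subseteq> \<Delta> \<and>
        g <#\<^bsub>BijGroup \<Delta>\<^esub> pointwise_stabilizer H S \<subseteq> U)"
  have mono: "g <#\<^bsub>BijGroup \<Delta>\<^esub> pointwise_stabilizer H (S \<union> S') \<subseteq>
      (g <#\<^bsub>BijGroup \<Delta>\<^esub> pointwise_stabilizer H S) \<inter>
      (g <#\<^bsub>BijGroup \<Delta>\<^esub> pointwise_stabilizer H S')" for g S S'
    by (auto simp: l_coset_def pointwise_stabilizer_def)
  have int: "?P (U \<inter> V)" if U: "?P U" and V: "?P V" for U V
  proof (intro conjI ballI)
    show "U \<inter> V \<subseteq> H" using U by blast
    fix g assume "g \<in> U \<inter> V"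
    then obtain S S' where "finite S" "S \<subseteq> \<Delta>" "finite S'" "S' \<subseteq> \<Delta>"
      "g <#\<^bsub>BijGroup \<Delta>\<^esub> pointwise_stabilizer H S \<subseteq> U"
      "g <#\<^bsub>BijGroup \<Delta>\<^esub> pointwise_stabilizer H S' \<subseteq> V"
      using U V by (metis IntD1 IntD2)
    then show "\<exists>S. finite S \<and> S \<subseteq> \<Delta> \<and>
        g <#\<^bsub>BijGroup \<Delta>\<^esub> pointwise_stabilizer H S \<subseteq> U \<inter> V"
      using mono[of g S S'] by (intro exI[of _ "S \<union> S'"]) auto
  qed
  have un: "?P (\<Union>K)" if K: "\<forall>U\<in>K. ?P U" for K
  proof (intro conjI ballI)
    show "\<Union>K \<subseteq> H" using K by blast
    fix g assume "g \<in> \<Union>K"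
    then obtain U where "U \<in> K" "g \<in> U" by blast
    with K obtain S where "finite S" "S \<subseteq> \<Delta>"
      "g <#\<^bsub>BijGroup \<Delta>\<^esub> pointwise_stabilizer H S \<subseteq> U" by metis
    then show "\<exists>S. finite S \<and> S \<subseteq> \<Delta> \<and>
        g <#\<^bsub>BijGroup \<Delta>\<^esub> pointwise_stabilizer H S \<subseteq> \<Union>K"
      using \<open>U \<in> K\<close> by blast
  qed
  have "istopology ?P"
    unfolding istopology_def using int un by blast
  then show ?thesis
    unfolding permutation_topology_def by (simp add: topology_inverse')
qed

text \<open>
  The unique group topology on \<open>\<G>(F,F')\<close> for which the inclusion of \<open>\<U>(F)\<close>, with its
  permutation topology, is continuous and open.
\<close>

definition restricted_topology ::
  "'i set \<Rightarrow> 'c set \<Rightarrow> ('i \<Rightarrow> ('c \<times> 'c) set) \<Rightarrow> ('i \<Rightarrow> 'a set) \<Rightarrow> ('i \<Rightarrow> 'c \<Rightarrow> 'a) \<Rightarrow>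
   ('i \<Rightarrow> ('a \<Rightarrow> 'a) set) \<Rightarrow> ('i \<Rightarrow> ('a \<Rightarrow> 'a) set) \<Rightarrow> ('c \<Rightarrow> 'c) topology" where
  "restricted_topology I \<Delta> E \<Omega> col F F' =
     (THE T. topological_group (restricted_universal_group I \<Delta> E \<Omega> col F F') T \<and>
        continuous_map (permutation_topology \<Delta> (universal_group I \<Delta> E \<Omega> col F)) T (\<lambda>g. g) \<and>
        open_map (permutation_topology \<Delta> (universal_group I \<Delta> E \<Omega> col F)) T (\<lambda>g. g))"

end

theory Submission
  imports Defs
begin

no_notation subset_mset (infix "<#" 50)

text \<open>
  The pointwise stabilizers in \<open>\<U>(F)\<close> of finite sets of chambers form a base of identity
  neighbourhoods for a group topology on \<open>\<G>(F,F')\<close> because each of them contains conjugates of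
  others by any given element: an element of \<open>\<G>(F,F')\<close> has only finitely many singular panels, all finite, so
  it suffices to fix their images as well. Each chamber separates automorphisms by clopen sets,
  which gives the Hausdorff property and total disconnectedness. The stabilizer in \<open>\<U>(F)\<close> of one
  chamber is open, and it is compact by Tychonoff's theorem: the building is connected with finite
  panels, so the orbits of chambers under the stabilizer are finite, and the stabilizer is closed
  under pointwise convergence.
\<close>

section \<open>Group topologies defined by a family of subgroups\<close>

text \<open>\<open>restricted_topology\<close> is a definite description, so nothing can be said
  about it before existence and uniqueness are both settled. The explicit
  \<open>coset_topology\<close> settles them, and every topological property is proved for it. The
  obstacle is that the topology inherited from all automorphisms is in general too coarse: an
  automorphism fixing many chambers may still have singular panels far away, so
  \<open>\<U> F\<close> need not be open there. The neighbourhoods are therefore taken inside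
  \<open>\<U> F\<close>, and their compatibility with conjugation by elements outside
  \<open>\<U> F\<close> is no longer automatic; this is where finiteness of the set of singular
  panels enters. On a single chamber stabilizer the finer topology is pointwise convergence again:
  two elements of \<open>\<U> F\<close> lie in the same coset of the stabilizer of \<open>S\<close>
  exactly when they agree on \<open>S\<close>. This is why a product of finite discrete spaces can
  be used there.\<close>

locale subgroup_base = group G for G (structure) +
  fixes \<N> :: "'a set set"
  assumes subgroup_mem: "N \<in> \<N> \<Longrightarrow> subgroup N G"
    and nonempty: "\<N> \<noteq> {}"
    and directed: "N \<in> \<N> \<Longrightarrow> N' \<in> \<N> \<Longrightarrow> \<exists>M\<in>\<N>. M \<subseteq> N \<inter> N'"
    and conj: "g \<in> carrier G \<Longrightarrow> N \<in> \<N> \<Longrightarrow> \<exists>M\<in>\<N>. \<forall>x\<in>M. inv g \<otimes> x \<otimes> g \<in> N"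
begin

text \<open>The neighbourhoods of \<open>g\<close> are generated by the left cosets
  \<open>g <# N\<close>. As the members of \<open>\<N>\<close> are subgroups, they are already
  closed under products and inverses; \<open>conj\<close> supplies what left cosets lack, namely
  that a small factor may be moved past a fixed element.\<close>

definition coset_topology :: "'a topology" where
  "coset_topology = topology (\<lambda>U. U \<subseteq> carrier G \<and> (\<forall>g\<in>U. \<exists>N\<in>\<N>. g <# N \<subseteq> U))"

lemma openin_coset_topology:
  "openin coset_topology U \<longleftrightarrow> U \<subseteq> carrier G \<and> (\<forall>g\<in>U. \<exists>N\<in>\<N>. g <# N \<subseteq> U)"
proof -
  let ?P = "\<lambda>U. U \<subseteq> carrier G \<and> (\<forall>g\<in>U. \<exists>N\<in>\<N>. g <# N \<subseteq> U)"
  have "?P (U \<inter> V)" if U: "?P U" and V: "?P V" for U V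
  proof (intro conjI ballI)
    show "U \<inter> V \<subseteq> carrier G" using U by blast
    fix g assume "g \<in> U \<inter> V"
    then obtain N N' where "N \<in> \<N>" "N' \<in> \<N>" and sub: "g <# N \<subseteq> U" "g <# N' \<subseteq> V"
      using U V by (metis IntD1 IntD2)
    then obtain M where M: "M \<in> \<N>" "M \<subseteq> N \<inter> N'" using directed by meson
    then have "g <# M \<subseteq> U \<inter> V" using sub unfolding l_coset_def by blast
    then show "\<exists>N\<in>\<N>. g <# N \<subseteq> U \<inter> V" using M by blast
  qed
  moreover have "?P (\<Union>K)" if K: "\<forall>U\<in>K. ?P U" for K
  proof (intro conjI ballI)
    show "\<Union>K \<subseteq> carrier G" using K by blast
    fix g assume "g \<in> \<Union>K"
    then obtain U where "U \<in> K" "g \<in> U" by blast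
    with K obtain N where "N \<in> \<N>" "g <# N \<subseteq> U" by metis
    then show "\<exists>N\<in>\<N>. g <# N \<subseteq> \<Union>K" using \<open>U \<in> K\<close> by blast
  qed
  ultimately have "istopology ?P" unfolding istopology_def by blast
  then show ?thesis unfolding coset_topology_def by (simp add: topology_inverse')
qed

lemma topspace_coset_topology: "topspace coset_topology = carrier G"
proof -
  obtain N where "N \<in> \<N>" using nonempty by blast
  then have "\<forall>g\<in>carrier G. g <# N \<subseteq> carrier G"
    using subgroup_mem l_coset_subset_G subgroup.subset by metis
  then have "openin coset_topology (carrier G)"
    unfolding openin_coset_topology using \<open>N \<in> \<N>\<close> by blast
  then show ?thesis
    by (meson openin_coset_topology openin_subset openin_topspace subset_antisym)
qed

lemma mem_l_coset_self: "N \<in> \<N> \<Longrightarrow> g \<in> carrier G \<Longrightarrow> g \<in> g <# N"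
  using subgroup.one_closed[OF subgroup_mem] r_one unfolding l_coset_def by force

text \<open>Every element of a left coset represents that coset, so the same \<open>N\<close> serves
  at all its points.\<close>

lemma openin_l_coset:
  assumes "N \<in> \<N>" and "g \<in> carrier G"
  shows "openin coset_topology (g <# N)"
  unfolding openin_coset_topology
proof (intro conjI ballI)
  interpret N: subgroup N G using assms subgroup_mem by blast
  show "g <# N \<subseteq> carrier G" using assms l_coset_subset_G N.subset by blast
  fix h assume "h \<in> g <# N"
  then have "h <# N = g <# N"
    using l_repr_independence[OF _ assms(2) N.is_subgroup] by simp
  then show "\<exists>N'\<in>\<N>. h <# N' \<subseteq> g <# N" using assms by blast
qed

text \<open>Moving the perturbation to the right end costs one conjugation:
  \<open>(g x)(h n)\<close> equals \<open>g h\<close> times \<open>(inv h x h) n\<close>, and the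
  inverse of \<open>g x\<close> is \<open>inv g\<close> times \<open>g (inv x) (inv g)\<close>. In
  both cases \<open>conj\<close> puts the second factor into the prescribed
  \<open>N\<close>.\<close>

lemma topological_group_coset_topology: "topological_group G coset_topology"
  unfolding topological_group_def
proof (intro conjI)
  show "group G" by (rule is_group)
  show "topspace coset_topology = carrier G" by (rule topspace_coset_topology)
  show "continuous_map (prod_topology coset_topology coset_topology) coset_topology
          (\<lambda>(x, y). x \<otimes> y)"
    unfolding continuous_map_def
  proof (intro conjI allI impI)
    show "(\<lambda>(x, y). x \<otimes> y) \<in> topspace (prod_topology coset_topology coset_topology) \<rightarrow>
        topspace coset_topology"
      by (auto simp: topspace_coset_topology)
    fix W assume W: "openin coset_topology W"
    show "openin (prod_topology coset_topology coset_topology)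
        {x \<in> topspace (prod_topology coset_topology coset_topology). (case x of (x, y) \<Rightarrow> x \<otimes> y) \<in> W}"
      unfolding openin_prod_topology_alt
    proof (intro allI impI)
      fix g h
      assume "(g, h) \<in> {x \<in> topspace (prod_topology coset_topology coset_topology).
          (case x of (x, y) \<Rightarrow> x \<otimes> y) \<in> W}"
      then have gh: "g \<in> carrier G" "h \<in> carrier G" "g \<otimes> h \<in> W"
        by (auto simp: topspace_coset_topology)
      then obtain N where N: "N \<in> \<N>" "(g \<otimes> h) <# N \<subseteq> W"
        using W openin_coset_topology by blast
      then obtain M where M: "M \<in> \<N>" "\<forall>x\<in>M. inv h \<otimes> x \<otimes> h \<in> N"
        using conj gh by blast
      interpret N: subgroup N G using N subgroup_mem by blast
      interpret M: subgroup M G using M subgroup_mem by blast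
      have "(g \<otimes> x) \<otimes> (h \<otimes> n) \<in> W" if "x \<in> M" "n \<in> N" for x n
      proof -
        have "h \<otimes> (inv h \<otimes> x \<otimes> h \<otimes> n) = x \<otimes> (h \<otimes> n)"
          using gh that by (simp add: m_assoc[symmetric])
        then have "(g \<otimes> x) \<otimes> (h \<otimes> n) = (g \<otimes> h) \<otimes> (inv h \<otimes> x \<otimes> h \<otimes> n)"
          using gh that by (simp add: m_assoc)
        moreover have "inv h \<otimes> x \<otimes> h \<otimes> n \<in> N" using M that by blast
        ultimately show ?thesis using N unfolding l_coset_def by blast
      qed
      then have "(g <# M) \<times> (h <# N) \<subseteq> {x \<in> topspace (prod_topology coset_topology coset_topology).
          (case x of (x, y) \<Rightarrow> x \<otimes> y) \<in> W}"
        using gh by (auto simp: topspace_coset_topology l_coset_def)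
      then show "\<exists>U V. openin coset_topology U \<and> openin coset_topology V \<and> g \<in> U \<and> h \<in> V \<and>
          U \<times> V \<subseteq> {x \<in> topspace (prod_topology coset_topology coset_topology).
            (case x of (x, y) \<Rightarrow> x \<otimes> y) \<in> W}"
        using openin_l_coset mem_l_coset_self M(1) N(1) gh(1,2) by meson
    qed
  qed
  show "continuous_map coset_topology coset_topology (\<lambda>x. inv x)"
    unfolding continuous_map_def
  proof (intro conjI allI impI)
    show "(\<lambda>x. inv x) \<in> topspace coset_topology \<rightarrow> topspace coset_topology"
      by (auto simp: topspace_coset_topology)
    fix W assume W: "openin coset_topology W"
    show "openin coset_topology {x \<in> topspace coset_topology. inv x \<in> W}"
      unfolding openin_coset_topology
    proof (intro conjI ballI)
      show "{x \<in> topspace coset_topology. inv x \<in> W} \<subseteq> carrier G"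
        by (auto simp: topspace_coset_topology)
      fix g assume "g \<in> {x \<in> topspace coset_topology. inv x \<in> W}"
      then have g: "g \<in> carrier G" "inv g \<in> W" by (auto simp: topspace_coset_topology)
      then obtain N where N: "N \<in> \<N>" "inv g <# N \<subseteq> W"
        using W openin_coset_topology by blast
      \<comment> \<open>Here \<open>conj\<close> is taken at \<open>inv g\<close>, because inversion
        requires conjugation in the opposite direction.\<close>
      then obtain M where M: "M \<in> \<N>" "\<forall>x\<in>M. inv (inv g) \<otimes> x \<otimes> inv g \<in> N"
        using conj g by blast
      interpret N: subgroup N G using N subgroup_mem by blast
      interpret M: subgroup M G using M subgroup_mem by blast
      have "inv (g \<otimes> x) \<in> W" if "x \<in> M" for x
      proof -
        have "inv (g \<otimes> x) = inv g \<otimes> (g \<otimes> inv x \<otimes> inv g)"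
          using g that by (simp add: m_assoc[symmetric] inv_mult_group)
        moreover have "g \<otimes> inv x \<otimes> inv g \<in> N" using M that g by force
        ultimately show ?thesis using N unfolding l_coset_def by blast
      qed
      then have "g <# M \<subseteq> {x \<in> topspace coset_topology. inv x \<in> W}"
        using g by (auto simp: topspace_coset_topology l_coset_def)
      then show "\<exists>N\<in>\<N>. g <# N \<subseteq> {x \<in> topspace coset_topology. inv x \<in> W}"
        using M by blast
    qed
  qed
qed

end

section \<open>Translations, uniqueness of the group topology, local compactness\<close>

lemma topological_group_continuous_l_mult:
  assumes "topological_group G T" and "g \<in> carrier G"
  shows "continuous_map T T (\<lambda>x. g \<otimes>\<^bsub>G\<^esub> x)"
proof -
  have "continuous_map T (prod_topology T T) (\<lambda>x. (g, x))"
    using assms by (simp add: continuous_map_pairwise comp_def topological_group_def)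
  then have "continuous_map T T ((\<lambda>(x, y). x \<otimes>\<^bsub>G\<^esub> y) \<circ> (\<lambda>x. (g, x)))"
    using assms continuous_map_compose unfolding topological_group_def by blast
  then show ?thesis by (simp add: comp_def)
qed

text \<open>The translate is the preimage of \<open>V\<close> under multiplication by the inverse of
  \<open>g\<close>. This carries information at the identity to every other point.\<close>

lemma topological_group_openin_l_coset:
  assumes TG: "topological_group G T" and g: "g \<in> carrier G" and V: "openin T V"
  shows "openin T (g <#\<^bsub>G\<^esub> V)"
proof -
  interpret group G using TG unfolding topological_group_def by blast
  have top: "topspace T = carrier G" using TG unfolding topological_group_def by blast
  have VG: "V \<subseteq> carrier G" using V openin_subset top by metis
  have "g <#\<^bsub>G\<^esub> V = {x \<in> topspace T. inv\<^bsub>G\<^esub> g \<otimes>\<^bsub>G\<^esub> x \<in> V}"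
  proof (intro equalityI subsetI)
    fix x assume "x \<in> g <#\<^bsub>G\<^esub> V"
    then obtain v where "v \<in> V" "x = g \<otimes>\<^bsub>G\<^esub> v" unfolding l_coset_def by blast
    then show "x \<in> {x \<in> topspace T. inv\<^bsub>G\<^esub> g \<otimes>\<^bsub>G\<^esub> x \<in> V}"
      using g VG top by (auto simp: m_assoc[symmetric] subset_iff)
  next
    fix x assume "x \<in> {x \<in> topspace T. inv\<^bsub>G\<^esub> g \<otimes>\<^bsub>G\<^esub> x \<in> V}"
    then have "inv\<^bsub>G\<^esub> g \<otimes>\<^bsub>G\<^esub> x \<in> V" "x = g \<otimes>\<^bsub>G\<^esub> (inv\<^bsub>G\<^esub> g \<otimes>\<^bsub>G\<^esub> x)"
      using g top by (auto simp: m_assoc[symmetric])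
    then show "x \<in> g <#\<^bsub>G\<^esub> V" unfolding l_coset_def by blast
  qed
  moreover have "continuous_map T T (\<lambda>x. inv\<^bsub>G\<^esub> g \<otimes>\<^bsub>G\<^esub> x)"
    using topological_group_continuous_l_mult[OF TG] g by simp
  ultimately show ?thesis
    using openin_continuous_map_preimage[OF _ V] by simp
qed

context subgroup_base
begin

text \<open>A group topology is determined by its neighbourhoods of the identity: translate an open
  set by \<open>inv g\<close>, compare at \<open>\<one>\<close> through \<open>op\<close> and
  \<open>nb\<close>, and translate back.\<close>

lemma coset_topology_unique:
  assumes TG: "topological_group G T"
    and op: "\<And>N. N \<in> \<N> \<Longrightarrow> openin T N"
    and nb: "\<And>V. openin T V \<Longrightarrow> \<one> \<in> V \<Longrightarrow> \<exists>N\<in>\<N>. N \<subseteq> V"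
  shows "T = coset_topology"
proof -
  have top: "topspace T = carrier G" using TG unfolding topological_group_def by blast
  have "openin T V \<longleftrightarrow> openin coset_topology V" for V
  proof
    assume V: "openin T V"
    then have VG: "V \<subseteq> carrier G" using openin_subset top by metis
    show "openin coset_topology V"
      unfolding openin_coset_topology
    proof (intro conjI ballI)
      fix g assume "g \<in> V"
      then have g: "g \<in> carrier G" using VG by blast
      have "openin T (inv g <# V)"
        using topological_group_openin_l_coset[OF TG] g V by simp
      moreover have "\<one> \<in> inv g <# V" using g \<open>g \<in> V\<close> l_inv unfolding l_coset_def by force
      ultimately obtain N where N: "N \<in> \<N>" "N \<subseteq> inv g <# V" using nb by metis
      have "g <# N \<subseteq> V"
      proof
        fix x assume "x \<in> g <# N"
        then obtain v where v: "v \<in> V" "x = g \<otimes> (inv g \<otimes> v)"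
          using N by (auto simp: l_coset_def)
        then have "v \<in> carrier G" using VG by blast
        then have "x = v" using g v(2) by (simp add: m_assoc[symmetric])
        then show "x \<in> V" using v(1) by simp
      qed
      then show "\<exists>N\<in>\<N>. g <# N \<subseteq> V" using N by blast
    qed (use VG in simp)
  next
    assume V: "openin coset_topology V"
    show "openin T V"
    proof (subst openin_subopen, intro ballI)
      fix g assume "g \<in> V"
      then obtain N where N: "N \<in> \<N>" "g <# N \<subseteq> V" "g \<in> carrier G"
        using V unfolding openin_coset_topology by blast
      then show "\<exists>W. openin T W \<and> g \<in> W \<and> W \<subseteq> V"
        using topological_group_openin_l_coset[OF TG N(3) op[OF N(1)]] mem_l_coset_self[OF N(1,3)]
        by blast
    qed
  qed
  then show ?thesis unfolding topology_eq by blast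
qed

text \<open>A member of \<open>\<N>\<close> is open, so a compact one is a compact neighbourhood of
  \<open>\<one>\<close>, and its left translates are compact neighbourhoods of the other
  points.\<close>

lemma locally_compact_coset_topology:
  assumes "K \<in> \<N>" and "compactin coset_topology K"
  shows "locally_compact_space coset_topology"
  unfolding locally_compact_space_def
proof
  fix g assume "g \<in> topspace coset_topology"
  then have g: "g \<in> carrier G" by (simp add: topspace_coset_topology)
  have "g <# K = (\<lambda>x. g \<otimes> x) ` K" by (auto simp: l_coset_def)
  moreover have "compactin coset_topology ((\<lambda>x. g \<otimes> x) ` K)"
    by (rule image_compactin[OF assms(2)
          topological_group_continuous_l_mult[OF topological_group_coset_topology g]])
  ultimately have "compactin coset_topology (g <# K)" by simp
  then show "\<exists>U K. openin coset_topology U \<and> compactin coset_topology K \<and> g \<in> U \<and> U \<subseteq> K"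
    using openin_l_coset[OF assms(1) g] mem_l_coset_self[OF assms(1) g] by blast
qed

end

section \<open>Compactness for pointwise convergence\<close>

text \<open>Prescribing finitely many coordinates is a basic open condition in a product of discrete
  spaces: the box has the factor \<open>{f c}\<close> for \<open>c\<close> in \<open>S\<close> and
  the full factor \<open>X c\<close> elsewhere.\<close>

lemma openin_product_discrete:
  assumes "A \<subseteq> PiE D X"
    and "\<And>f. f \<in> A \<Longrightarrow> \<exists>S. finite S \<and> S \<subseteq> D \<and> (\<forall>h\<in>PiE D X. (\<forall>s\<in>S. h s = f s) \<longrightarrow> h \<in> A)"
  shows "openin (product_topology (\<lambda>c. discrete_topology (X c)) D) A"
  unfolding openin_product_topology_alt
proof (intro ballI)
  fix f assume f: "f \<in> A"
  then obtain S where S: "finite S" "S \<subseteq> D" "\<forall>h\<in>PiE D X. (\<forall>s\<in>S. h s = f s) \<longrightarrow> h \<in> A"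
    using assms(2)[OF f] by blast
  let ?U = "\<lambda>c. if c \<in> S then {f c} else X c"
  have fX: "f \<in> PiE D X" using f assms(1) by blast
  have "{i \<in> D. ?U i \<noteq> topspace (discrete_topology (X i))} \<subseteq> S" by auto
  then have "finite {i \<in> D. ?U i \<noteq> topspace (discrete_topology (X i))}"
    using S(1) by (rule finite_subset)
  moreover have "\<forall>i\<in>D. openin (discrete_topology (X i)) (?U i)" using fX by auto
  moreover have "f \<in> PiE D ?U" using fX by (auto simp: PiE_iff)
  moreover have "PiE D ?U \<subseteq> A"
  proof
    fix h assume h: "h \<in> PiE D ?U"
    have mem: "h c \<in> ?U c" if "c \<in> D" for c using h that by (rule PiE_mem)
    have "\<forall>s\<in>S. h s = f s"
    proof
      fix s assume "s \<in> S"
      then show "h s = f s" using mem[of s] S(2) by auto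
    qed
    moreover have "h \<in> PiE D X"
    proof (rule PiE_I)
      fix c assume "c \<in> D"
      then show "h c \<in> X c" using mem[of c] PiE_mem[OF fX] by (cases "c \<in> S") auto
    qed (use PiE_arb[OF h] in blast)
    ultimately show "h \<in> A" using S(3) by blast
  qed
  ultimately show "\<exists>U. finite {i \<in> D. U i \<noteq> topspace (discrete_topology (X i))} \<and>
      (\<forall>i\<in>D. openin (discrete_topology (X i)) (U i)) \<and> f \<in> PiE D U \<and> PiE D U \<subseteq> A"
    by (intro exI[of _ ?U] conjI)
qed

text \<open>By \<open>closed\<close> and Tychonoff's theorem, \<open>K\<close> is compact for
  pointwise convergence. By \<open>fine\<close>, the topology induced on \<open>K\<close> by
  \<open>T\<close> is no finer than that, so the identity map carries compactness over to
  \<open>T\<close>.\<close>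

lemma compactin_pointwise:
  assumes fin: "\<And>c. c \<in> D \<Longrightarrow> finite (X c)"
    and KX: "K \<subseteq> PiE D X"
    and KT: "K \<subseteq> topspace T"
    and closed: "\<And>f. f \<in> PiE D X - K \<Longrightarrow>
      \<exists>S. finite S \<and> S \<subseteq> D \<and> (\<forall>h\<in>K. \<exists>s\<in>S. h s \<noteq> f s)"
    and fine: "\<And>V g. openin T V \<Longrightarrow> g \<in> V \<inter> K \<Longrightarrow>
      \<exists>S. finite S \<and> S \<subseteq> D \<and> (\<forall>h\<in>K. (\<forall>s\<in>S. h s = g s) \<longrightarrow> h \<in> V)"
  shows "compactin T K"
proof -
  let ?P = "product_topology (\<lambda>c. discrete_topology (X c)) D"
  have "openin ?P (PiE D X - K)"
  proof (rule openin_product_discrete)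
    fix f assume f: "f \<in> PiE D X - K"
    then obtain S where "finite S" "S \<subseteq> D" "\<forall>h\<in>K. \<exists>s\<in>S. h s \<noteq> f s"
      using closed[OF f] by blast
    then show "\<exists>S. finite S \<and> S \<subseteq> D \<and>
        (\<forall>h\<in>PiE D X. (\<forall>s\<in>S. h s = f s) \<longrightarrow> h \<in> PiE D X - K)"
      by (intro exI[of _ S]) blast
  qed blast
  then have "closedin ?P K" using KX by (simp add: closedin_def)
  moreover have "compact_space ?P" 
    using fin by (simp add: compact_space_product_topology compact_space_discrete_topology)
  ultimately have "compactin ?P K" by (simp add: closedin_compact_space)
  then have cK: "compactin (subtopology ?P K) K" by (simp add: compactin_subtopology)
  have "continuous_map (subtopology ?P K) T id"
    unfolding continuous_map_def
  proof (intro conjI allI impI)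
    show "id \<in> topspace (subtopology ?P K) \<rightarrow> topspace T" using KT by auto
    fix V assume V: "openin T V"
    \<comment> \<open>\<open>V\<close> itself says nothing about points of the product outside
      \<open>K\<close>, so an open set of the product with the same trace on \<open>K\<close> is
      built: the union \<open>A\<close> of cylinders around points \<open>g\<close> of
      \<open>V \<inter> K\<close>, with \<open>S\<close> so large that the cylinder meets
      \<open>K\<close> only inside \<open>V\<close>.\<close>
    define Q where "Q g S \<longleftrightarrow> finite S \<and> S \<subseteq> D \<and> g \<in> V \<inter> K \<and>
      (\<forall>h\<in>K. (\<forall>s\<in>S. h s = g s) \<longrightarrow> h \<in> V)" for g S
    define A where "A = {f \<in> PiE D X. \<exists>S g. Q g S \<and> (\<forall>s\<in>S. f s = g s)}"
    have "openin ?P A"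
    proof (rule openin_product_discrete)
      fix f assume "f \<in> A"
      then obtain S g where S: "Q g S" "\<forall>s\<in>S. f s = g s"
        unfolding A_def by blast
      have "h \<in> A" if "h \<in> PiE D X" "\<forall>s\<in>S. h s = f s" for h
      proof -
        have "\<forall>s\<in>S. h s = g s" using that S(2) by simp
        then show ?thesis using that(1) S(1) unfolding A_def by blast
      qed
      moreover have "finite S" "S \<subseteq> D" using S(1) unfolding Q_def by simp_all
      ultimately show "\<exists>S. finite S \<and> S \<subseteq> D \<and> (\<forall>h\<in>PiE D X. (\<forall>s\<in>S. h s = f s) \<longrightarrow> h \<in> A)"
        by meson
    qed (simp add: A_def)
    moreover have "A \<inter> K = V \<inter> K"
    proof (intro equalityI subsetI)
      fix f assume f: "f \<in> A \<inter> K"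
      then obtain S g where S: "Q g S" "\<forall>s\<in>S. f s = g s"
        unfolding A_def by blast
      then show "f \<in> V \<inter> K" using f unfolding Q_def by simp
    next
      fix g assume g: "g \<in> V \<inter> K"
      obtain S where "finite S" "S \<subseteq> D" "\<forall>h\<in>K. (\<forall>s\<in>S. h s = g s) \<longrightarrow> h \<in> V"
        using fine[OF V g] by blast
      then have "Q g S" using g unfolding Q_def by simp
      moreover have "g \<in> PiE D X" using g KX by blast
      ultimately show "g \<in> A \<inter> K" using g unfolding A_def by blast
    qed
    moreover have "{x \<in> topspace (subtopology ?P K). id x \<in> V} = V \<inter> K" using KX by auto
    ultimately show "openin (subtopology ?P K) {x \<in> topspace (subtopology ?P K). id x \<in> V}"
      unfolding openin_subtopology by metis
  qed
  from image_compactin[OF cK this] show ?thesis by simp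
qed

section \<open>Local actions of automorphisms\<close>

lemma BijGroup_mult_apply:
  "g \<in> Bij D \<Longrightarrow> h \<in> Bij D \<Longrightarrow> x \<in> D \<Longrightarrow> (g \<otimes>\<^bsub>BijGroup D\<^esub> h) x = g (h x)"
  by (simp add: BijGroup_def compose_def)

lemma carrier_BijGroup [simp]: "carrier (BijGroup D) = Bij D"
  by (simp add: BijGroup_def)

lemma BijGroup_one_apply: "x \<in> D \<Longrightarrow> \<one>\<^bsub>BijGroup D\<^esub> x = x"
  by (simp add: BijGroup_def)

lemma Bij_mem: "g \<in> Bij D \<Longrightarrow> x \<in> D \<Longrightarrow> g x \<in> D"
  using Bij_imp_funcset by blast

lemma Bij_inj: "g \<in> Bij D \<Longrightarrow> x \<in> D \<Longrightarrow> y \<in> D \<Longrightarrow> g x = g y \<longleftrightarrow> x = y"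
  by (auto simp: Bij_def bij_betw_def dest: inj_onD)

lemma Bij_eqI: "g \<in> Bij D \<Longrightarrow> h \<in> Bij D \<Longrightarrow> (\<And>x. x \<in> D \<Longrightarrow> g x = h x) \<Longrightarrow> g = h"
  using Bij_imp_extensional extensionalityI by metis

lemma BijGroup_inv_Bij: "g \<in> Bij D \<Longrightarrow> inv\<^bsub>BijGroup D\<^esub> g \<in> Bij D"
  using group.inv_closed[OF group_BijGroup, of g D] by simp

lemma BijGroup_inv_apply_left:
  assumes "g \<in> Bij D" and "x \<in> D"
  shows "(inv\<^bsub>BijGroup D\<^esub> g) (g x) = x"
  using group.l_inv[OF group_BijGroup, of g D] assms
  by (metis BijGroup_inv_Bij BijGroup_mult_apply BijGroup_one_apply carrier_BijGroup)

lemma BijGroup_inv_apply_right: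
  assumes "g \<in> Bij D" and "x \<in> D"
  shows "g ((inv\<^bsub>BijGroup D\<^esub> g) x) = x"
  using group.r_inv[OF group_BijGroup, of g D] assms
  by (metis BijGroup_inv_Bij BijGroup_mult_apply BijGroup_one_apply carrier_BijGroup)

locale legally_colored =
  fixes I :: "'i set" and \<Delta> :: "'c set" and E :: "'i \<Rightarrow> ('c \<times> 'c) set"
    and \<Omega> :: "'i \<Rightarrow> 'a set" and col :: "'i \<Rightarrow> 'c \<Rightarrow> 'a"
  assumes chamber_system: "chamber_system I \<Delta> E"
    and legal_coloring: "legal_coloring I \<Delta> E \<Omega> col"
    and finite_panels: "i \<in> I \<Longrightarrow> P \<in> \<Delta> // E i \<Longrightarrow> finite P"
begin

abbreviation "aut \<equiv> building_aut I \<Delta> E"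
abbreviation "\<sigma> \<equiv> local_action \<Omega> col"
abbreviation "\<U> \<equiv> universal_group I \<Delta> E \<Omega> col"
abbreviation "\<G> \<equiv> almost_universal_group I \<Delta> E \<Omega> col"

section \<open>Panels and type-preserving automorphisms\<close>

lemma equiv: "i \<in> I \<Longrightarrow> equiv \<Delta> (E i)"
  using chamber_system unfolding chamber_system_def by blast

lemma edge_chambers: "i \<in> I \<Longrightarrow> (x, y) \<in> E i \<Longrightarrow> x \<in> \<Delta> \<and> y \<in> \<Delta>"
  using equiv_type[OF equiv] by blast

lemma panel_subset: "i \<in> I \<Longrightarrow> P \<in> \<Delta> // E i \<Longrightarrow> P \<subseteq> \<Delta>"
  using in_quotient_imp_subset[OF equiv] .

lemma panel_mem_eq: "i \<in> I \<Longrightarrow> P \<in> \<Delta> // E i \<Longrightarrow> x \<in> P \<Longrightarrow> P = E i `` {x}"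
  by (metis Image_singleton_iff equiv equiv_class_eq_iff quotientE)

lemma panel_of: "i \<in> I \<Longrightarrow> x \<in> \<Delta> \<Longrightarrow> E i `` {x} \<in> \<Delta> // E i \<and> x \<in> E i `` {x}"
  using equiv_class_self[OF equiv] quotientI by metis

lemma panel_bij: "i \<in> I \<Longrightarrow> P \<in> \<Delta> // E i \<Longrightarrow> bij_betw (col i) P (\<Omega> i)"
  using legal_coloring unfolding legal_coloring_def by blast

lemma aut_Bij: "g \<in> aut \<Longrightarrow> g \<in> Bij \<Delta>"
  unfolding building_aut_def by blast

lemma aut_edge: "g \<in> aut \<Longrightarrow> i \<in> I \<Longrightarrow> x \<in> \<Delta> \<Longrightarrow> y \<in> \<Delta> \<Longrightarrow> (g x, g y) \<in> E i \<longleftrightarrow> (x, y) \<in> E i"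
  unfolding building_aut_def by blast

lemma subgroup_aut: "subgroup aut (BijGroup \<Delta>)"
proof (rule group.subgroupI[OF group_BijGroup])
  show "aut \<subseteq> carrier (BijGroup \<Delta>)" using aut_Bij by auto
  have "\<one>\<^bsub>BijGroup \<Delta>\<^esub> \<in> aut"
    unfolding building_aut_def using id_Bij by (auto simp: BijGroup_def)
  then show "aut \<noteq> {}" by blast
  fix g assume g: "g \<in> aut"
  note gB = aut_Bij[OF g] and iB = BijGroup_inv_Bij[OF aut_Bij[OF g]]
  have "(x, y) \<in> E i \<longleftrightarrow> ((inv\<^bsub>BijGroup \<Delta>\<^esub> g) x, (inv\<^bsub>BijGroup \<Delta>\<^esub> g) y) \<in> E i"
    if "i \<in> I" "x \<in> \<Delta>" "y \<in> \<Delta>" for i x y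
    using aut_edge[OF g that(1) Bij_mem[OF iB that(2)] Bij_mem[OF iB that(3)]] that
    by (simp add: BijGroup_inv_apply_right[OF gB])
  then show "inv\<^bsub>BijGroup \<Delta>\<^esub> g \<in> aut"
    using iB unfolding building_aut_def by blast
  fix h assume h: "h \<in> aut"
  note hB = aut_Bij[OF h]
  have "g \<otimes>\<^bsub>BijGroup \<Delta>\<^esub> h \<in> Bij \<Delta>"
    using group.subgroup_self[OF group_BijGroup, THEN subgroup.m_closed, of g \<Delta> h] gB hB by simp
  moreover have "(x, y) \<in> E i \<longleftrightarrow> ((g \<otimes>\<^bsub>BijGroup \<Delta>\<^esub> h) x, (g \<otimes>\<^bsub>BijGroup \<Delta>\<^esub> h) y) \<in> E i"
    if "i \<in> I" "x \<in> \<Delta>" "y \<in> \<Delta>" for i x y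
    using aut_edge[OF g that(1) Bij_mem[OF hB that(2)] Bij_mem[OF hB that(3)]] aut_edge[OF h] that
    by (simp add: BijGroup_mult_apply[OF gB hB])
  ultimately show "g \<otimes>\<^bsub>BijGroup \<Delta>\<^esub> h \<in> aut"
    unfolding building_aut_def by blast
qed

lemma aut_panel:
  assumes g: "g \<in> aut" and i: "i \<in> I" and P: "P \<in> \<Delta> // E i"
  shows "g ` P \<in> \<Delta> // E i"
proof -
  obtain x where x: "x \<in> \<Delta>" "P = E i `` {x}" using P by (rule quotientE)
  have "g ` P = E i `` {g x}"
  proof (intro equalityI subsetI)
    fix y assume "y \<in> g ` P"
    then show "y \<in> E i `` {g x}" using x aut_edge[OF g i] edge_chambers[OF i] by auto
  next
    fix y assume y: "y \<in> E i `` {g x}"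
    then have "y \<in> \<Delta>" using edge_chambers[OF i] by blast
    then obtain z where z: "z \<in> \<Delta>" "y = g z"
      using aut_Bij[OF g] unfolding Bij_def bij_betw_def by blast
    then show "y \<in> g ` P" using y x aut_edge[OF g i] by auto
  qed
  then show ?thesis using quotientI[OF Bij_mem[OF aut_Bij[OF g] x(1)]] by simp
qed

text \<open>Injectivity of the coloring on \<open>P\<close> removes \<open>inv_into\<close> from the
  definition. Together with \<open>panel_color_cases\<close>, local actions can then be computed on
  chambers instead of colors.\<close>

lemma local_action_apply:
  assumes "i \<in> I" and "P \<in> \<Delta> // E i" and "x \<in> P"
  shows "\<sigma> i g P (col i x) = col i (g x)"
  using panel_bij[OF assms(1,2)] assms(3)
  by (simp add: local_action_def bij_betw_inv_into_left bij_betw_apply)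

lemma panel_color_cases:
  assumes "i \<in> I" and "P \<in> \<Delta> // E i" and "\<omega> \<in> \<Omega> i"
  obtains x where "x \<in> P" and "\<omega> = col i x"
  using panel_bij[OF assms(1,2)] assms(3) unfolding bij_betw_def by blast

lemma local_action_Bij:
  assumes g: "g \<in> aut" and i: "i \<in> I" and P: "P \<in> \<Delta> // E i"
  shows "\<sigma> i g P \<in> Bij (\<Omega> i)"
proof -
  have "bij_betw g P (g ` P)"
    using aut_Bij[OF g] panel_subset[OF i P] unfolding Bij_def
    by (auto intro: bij_betw_subset)
  then have "bij_betw (\<lambda>\<omega>. col i (g (inv_into P (col i) \<omega>))) (\<Omega> i) (\<Omega> i)"
    using bij_betw_trans[OF bij_betw_trans[OF bij_betw_inv_into[OF panel_bij[OF i P]]]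
        panel_bij[OF i aut_panel[OF g i P]]]
    by (simp add: comp_def)
  then have "bij_betw (\<sigma> i g P) (\<Omega> i) (\<Omega> i)"
    unfolding local_action_def by simp
  then show ?thesis unfolding Bij_def local_action_def by simp
qed

text \<open>This transfers local actions from approximating automorphisms to a pointwise limit,
  which is not yet known to be an automorphism; hence no assumption that \<open>g\<close> or
  \<open>h\<close> is one.\<close>

lemma local_action_cong:
  assumes "i \<in> I" and "P \<in> \<Delta> // E i" and "\<And>x. x \<in> P \<Longrightarrow> g x = h x"
  shows "\<sigma> i g P = \<sigma> i h P"
  unfolding local_action_def
proof (rule restrict_ext)
  fix \<omega> assume "\<omega> \<in> \<Omega> i"
  then have "inv_into P (col i) \<omega> \<in> P"
    using panel_bij[OF assms(1,2)] by (simp add: bij_betw_def inv_into_into)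
  then show "col i (g (inv_into P (col i) \<omega>)) = col i (h (inv_into P (col i) \<omega>))"
    using assms(3) by simp
qed

lemma local_action_fix:
  assumes "i \<in> I" and "P \<in> \<Delta> // E i" and "\<And>x. x \<in> P \<Longrightarrow> g x = x"
  shows "\<sigma> i g P = \<one>\<^bsub>BijGroup (\<Omega> i)\<^esub>"
proof (rule extensionalityI)
  show "\<sigma> i g P \<in> extensional (\<Omega> i)" by (simp add: local_action_def)
  show "\<one>\<^bsub>BijGroup (\<Omega> i)\<^esub> \<in> extensional (\<Omega> i)" by (simp add: BijGroup_def)
  fix \<omega> assume \<omega>: "\<omega> \<in> \<Omega> i"
  then obtain x where "x \<in> P" "\<omega> = col i x" using panel_color_cases assms by metis
  then show "\<sigma> i g P \<omega> = \<one>\<^bsub>BijGroup (\<Omega> i)\<^esub> \<omega>"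
    using \<omega> local_action_apply[OF assms(1,2)] assms(3) by (simp add: BijGroup_one_apply)
qed

text \<open>The cocycle identity: \<open>h\<close> carries \<open>P\<close> to its image panel, and
  \<open>g\<close> acts from there. Membership of local actions in \<open>F\<close> is always
  decided by this identity and its consequence for inverses.\<close>

lemma local_action_mult:
  assumes g: "g \<in> aut" and h: "h \<in> aut" and i: "i \<in> I" and P: "P \<in> \<Delta> // E i"
  shows "\<sigma> i (g \<otimes>\<^bsub>BijGroup \<Delta>\<^esub> h) P = \<sigma> i g (h ` P) \<otimes>\<^bsub>BijGroup (\<Omega> i)\<^esub> \<sigma> i h P"
proof -
  note hP = aut_panel[OF h i P]
  note gh = subgroup.m_closed[OF subgroup_aut g h]
  note gB = local_action_Bij[OF g i hP] and hB = local_action_Bij[OF h i P]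
  show ?thesis
  proof (rule Bij_eqI[OF local_action_Bij[OF gh i P]])
    show "\<sigma> i g (h ` P) \<otimes>\<^bsub>BijGroup (\<Omega> i)\<^esub> \<sigma> i h P \<in> Bij (\<Omega> i)"
      using group.subgroup_self[OF group_BijGroup, THEN subgroup.m_closed] gB hB
      by (metis carrier_BijGroup)
    fix \<omega> assume \<omega>: "\<omega> \<in> \<Omega> i"
    then obtain x where x: "x \<in> P" "\<omega> = col i x" using panel_color_cases i P by metis
    then have "x \<in> \<Delta>" using panel_subset[OF i P] by blast
    then have "\<sigma> i (g \<otimes>\<^bsub>BijGroup \<Delta>\<^esub> h) P \<omega> = col i (g (h x))"
      using local_action_apply[OF i P x(1)] x(2) BijGroup_mult_apply[OF aut_Bij[OF g] aut_Bij[OF h]]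
      by simp
    also have "\<dots> = \<sigma> i g (h ` P) (\<sigma> i h P \<omega>)"
      using local_action_apply[OF i P x(1)] local_action_apply[OF i hP] x by simp
    finally show "\<sigma> i (g \<otimes>\<^bsub>BijGroup \<Delta>\<^esub> h) P \<omega> =
        (\<sigma> i g (h ` P) \<otimes>\<^bsub>BijGroup (\<Omega> i)\<^esub> \<sigma> i h P) \<omega>"
      using BijGroup_mult_apply[OF gB hB \<omega>] by simp
  qed
qed

lemma local_action_inv:
  assumes g: "g \<in> aut" and i: "i \<in> I" and P: "P \<in> \<Delta> // E i"
  shows "\<sigma> i (inv\<^bsub>BijGroup \<Delta>\<^esub> g) (g ` P) = inv\<^bsub>BijGroup (\<Omega> i)\<^esub> \<sigma> i g P"
proof -
  note g' = subgroup.m_inv_closed[OF subgroup_aut g]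
  have "\<sigma> i (inv\<^bsub>BijGroup \<Delta>\<^esub> g) (g ` P) \<otimes>\<^bsub>BijGroup (\<Omega> i)\<^esub> \<sigma> i g P =
      \<sigma> i (inv\<^bsub>BijGroup \<Delta>\<^esub> g \<otimes>\<^bsub>BijGroup \<Delta>\<^esub> g) P"
    using local_action_mult[OF g' g i P] by simp
  also have "\<dots> = \<sigma> i \<one>\<^bsub>BijGroup \<Delta>\<^esub> P"
    using group.l_inv[OF group_BijGroup] aut_Bij[OF g] by (metis carrier_BijGroup)
  also have "\<dots> = \<one>\<^bsub>BijGroup (\<Omega> i)\<^esub>"
    using panel_subset[OF i P] by (intro local_action_fix[OF i P] BijGroup_one_apply) blast
  finally have "\<sigma> i (inv\<^bsub>BijGroup \<Delta>\<^esub> g) (g ` P) \<otimes>\<^bsub>BijGroup (\<Omega> i)\<^esub> \<sigma> i g P =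
      \<one>\<^bsub>BijGroup (\<Omega> i)\<^esub>" .
  then show ?thesis
    using group.inv_equality[OF group_BijGroup] local_action_Bij[OF g i P]
      local_action_Bij[OF g' i aut_panel[OF g i P]]
    by (metis carrier_BijGroup)
qed

lemma image_inv_image:
  assumes "g \<in> aut" and "i \<in> I" and "P \<in> \<Delta> // E i"
  shows "g ` (inv\<^bsub>BijGroup \<Delta>\<^esub> g) ` P = P"
proof -
  have "g ((inv\<^bsub>BijGroup \<Delta>\<^esub> g) x) = x" if "x \<in> P" for x
    using that panel_subset[OF assms(2,3)] BijGroup_inv_apply_right[OF aut_Bij[OF assms(1)]] by blast
  then show ?thesis by (simp add: image_image)
qed

text \<open>By the cocycle identity, a singular panel of a product \<open>g h\<close> is singular
  for \<open>h\<close> or is carried by \<open>h\<close> to a singular panel of \<open>g\<close>;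
  the singular panels of the inverse of \<open>g\<close> are images of those of \<open>g\<close>.
  Both sets are finite.\<close>

lemma subgroup_almost_universal:
  assumes F: "local_data I \<Omega> F"
  shows "subgroup (\<G> F) (BijGroup \<Delta>)"
proof (rule group.subgroupI[OF group_BijGroup])
  have FI: "subgroup (F i) (BijGroup (\<Omega> i))" if "i \<in> I" for i
    using F that unfolding local_data_def by blast
  show "\<G> F \<subseteq> carrier (BijGroup \<Delta>)"
    using aut_Bij unfolding almost_universal_group_def by auto
  have "\<sigma> i \<one>\<^bsub>BijGroup \<Delta>\<^esub> P \<in> F i" if "i \<in> I" "P \<in> \<Delta> // E i" for i P
  proof -
    have "\<sigma> i \<one>\<^bsub>BijGroup \<Delta>\<^esub> P = \<one>\<^bsub>BijGroup (\<Omega> i)\<^esub>"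
      using panel_subset[OF that] by (intro local_action_fix[OF that] BijGroup_one_apply) blast
    then show ?thesis using subgroup.one_closed[OF FI[OF that(1)]] by simp
  qed
  then have "finite {P \<in> \<Delta> // E i. \<sigma> i \<one>\<^bsub>BijGroup \<Delta>\<^esub> P \<notin> F i}" if "i \<in> I" for i
    using that not_finite_existsD by blast
  then have "\<one>\<^bsub>BijGroup \<Delta>\<^esub> \<in> \<G> F"
    unfolding almost_universal_group_def using subgroup.one_closed[OF subgroup_aut] by blast
  then show "\<G> F \<noteq> {}" by blast
  fix g assume "g \<in> \<G> F"
  then have g: "g \<in> aut" and gf: "\<And>i. i \<in> I \<Longrightarrow> finite {P \<in> \<Delta> // E i. \<sigma> i g P \<notin> F i}"
    unfolding almost_universal_group_def by blast+
  note g' = subgroup.m_inv_closed[OF subgroup_aut g]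
  have "finite {P \<in> \<Delta> // E i. \<sigma> i (inv\<^bsub>BijGroup \<Delta>\<^esub> g) P \<notin> F i}" if i: "i \<in> I" for i
  proof (rule finite_subset)
    show "finite ((`) g ` {P \<in> \<Delta> // E i. \<sigma> i g P \<notin> F i})" using gf[OF i] by simp
    show "{P \<in> \<Delta> // E i. \<sigma> i (inv\<^bsub>BijGroup \<Delta>\<^esub> g) P \<notin> F i} \<subseteq>
        (`) g ` {P \<in> \<Delta> // E i. \<sigma> i g P \<notin> F i}"
    proof
      fix P assume "P \<in> {P \<in> \<Delta> // E i. \<sigma> i (inv\<^bsub>BijGroup \<Delta>\<^esub> g) P \<notin> F i}"
      then have P: "P \<in> \<Delta> // E i" and bad: "\<sigma> i (inv\<^bsub>BijGroup \<Delta>\<^esub> g) P \<notin> F i" by blast+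
      let ?Q = "(inv\<^bsub>BijGroup \<Delta>\<^esub> g) ` P"
      have Q: "?Q \<in> \<Delta> // E i" by (rule aut_panel[OF g' i P])
      have "\<sigma> i g ?Q \<notin> F i"
        using bad local_action_inv[OF g i Q] subgroup.m_inv_closed[OF FI[OF i]]
        by (auto simp: image_inv_image[OF g i P])
      then show "P \<in> (`) g ` {P \<in> \<Delta> // E i. \<sigma> i g P \<notin> F i}"
        using Q image_inv_image[OF g i P] by blast
    qed
  qed
  then show "inv\<^bsub>BijGroup \<Delta>\<^esub> g \<in> \<G> F"
    using g' unfolding almost_universal_group_def by blast
  fix h assume "h \<in> \<G> F"
  then have h: "h \<in> aut" and hf: "\<And>i. i \<in> I \<Longrightarrow> finite {P \<in> \<Delta> // E i. \<sigma> i h P \<notin> F i}"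
    unfolding almost_universal_group_def by blast+
  have "finite {P \<in> \<Delta> // E i. \<sigma> i (g \<otimes>\<^bsub>BijGroup \<Delta>\<^esub> h) P \<notin> F i}" if i: "i \<in> I" for i
  proof (rule finite_subset)
    let ?B = "{P \<in> \<Delta> // E i. \<sigma> i h P \<notin> F i} \<union>
        (`) (inv\<^bsub>BijGroup \<Delta>\<^esub> h) ` {P \<in> \<Delta> // E i. \<sigma> i g P \<notin> F i}"
    show "finite ?B" using gf[OF i] hf[OF i] by simp
    show "{P \<in> \<Delta> // E i. \<sigma> i (g \<otimes>\<^bsub>BijGroup \<Delta>\<^esub> h) P \<notin> F i} \<subseteq> ?B"
    proof
      fix P assume "P \<in> {P \<in> \<Delta> // E i. \<sigma> i (g \<otimes>\<^bsub>BijGroup \<Delta>\<^esub> h) P \<notin> F i}"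
      then have P: "P \<in> \<Delta> // E i" and "\<sigma> i (g \<otimes>\<^bsub>BijGroup \<Delta>\<^esub> h) P \<notin> F i" by blast+
      then have "\<sigma> i h P \<notin> F i \<or> \<sigma> i g (h ` P) \<notin> F i"
        using local_action_mult[OF g h i P] subgroup.m_closed[OF FI[OF i]] by metis
      moreover have "P = (inv\<^bsub>BijGroup \<Delta>\<^esub> h) ` h ` P"
      proof -
        have "(inv\<^bsub>BijGroup \<Delta>\<^esub> h) (h x) = x" if "x \<in> P" for x
          using that panel_subset[OF i P] BijGroup_inv_apply_left[OF aut_Bij[OF h]] by blast
        then show ?thesis by (simp add: image_image)
      qed
      ultimately show "P \<in> ?B" using P aut_panel[OF h i P] by blast
    qed
  qed
  then show "g \<otimes>\<^bsub>BijGroup \<Delta>\<^esub> h \<in> \<G> F"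
    using subgroup.m_closed[OF subgroup_aut g h] unfolding almost_universal_group_def by blast
qed

lemma subgroup_universal:
  assumes F: "local_data I \<Omega> F"
  shows "subgroup (\<U> F) (BijGroup \<Delta>)"
proof (rule group.subgroupI[OF group_BijGroup])
  have FI: "subgroup (F i) (BijGroup (\<Omega> i))" if "i \<in> I" for i
    using F that unfolding local_data_def by blast
  show "\<U> F \<subseteq> carrier (BijGroup \<Delta>)"
    using aut_Bij unfolding universal_group_def by auto
  have "\<sigma> i \<one>\<^bsub>BijGroup \<Delta>\<^esub> P \<in> F i" if "i \<in> I" "P \<in> \<Delta> // E i" for i P
  proof -
    have "\<sigma> i \<one>\<^bsub>BijGroup \<Delta>\<^esub> P = \<one>\<^bsub>BijGroup (\<Omega> i)\<^esub>"
      using panel_subset[OF that] by (intro local_action_fix[OF that] BijGroup_one_apply) blast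
    then show ?thesis using subgroup.one_closed[OF FI[OF that(1)]] by simp
  qed
  then have "\<one>\<^bsub>BijGroup \<Delta>\<^esub> \<in> \<U> F"
    unfolding universal_group_def using subgroup.one_closed[OF subgroup_aut] by simp
  then show "\<U> F \<noteq> {}" by blast
  fix g assume "g \<in> \<U> F"
  then have g: "g \<in> aut" and gf: "\<And>i P. i \<in> I \<Longrightarrow> P \<in> \<Delta> // E i \<Longrightarrow> \<sigma> i g P \<in> F i"
    unfolding universal_group_def by blast+
  note g' = subgroup.m_inv_closed[OF subgroup_aut g]
  have "\<sigma> i (inv\<^bsub>BijGroup \<Delta>\<^esub> g) P \<in> F i" if i: "i \<in> I" and P: "P \<in> \<Delta> // E i" for i P
    using local_action_inv[OF g i aut_panel[OF g' i P]] image_inv_image[OF g i P]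
      subgroup.m_inv_closed[OF FI[OF i] gf[OF i aut_panel[OF g' i P]]] by simp
  then show "inv\<^bsub>BijGroup \<Delta>\<^esub> g \<in> \<U> F"
    using g' unfolding universal_group_def by blast
  fix h assume "h \<in> \<U> F"
  then have h: "h \<in> aut" and hf: "\<And>i P. i \<in> I \<Longrightarrow> P \<in> \<Delta> // E i \<Longrightarrow> \<sigma> i h P \<in> F i"
    unfolding universal_group_def by blast+
  have "\<sigma> i (g \<otimes>\<^bsub>BijGroup \<Delta>\<^esub> h) P \<in> F i" if i: "i \<in> I" and P: "P \<in> \<Delta> // E i" for i P
    using local_action_mult[OF g h i P]
      subgroup.m_closed[OF FI[OF i] gf[OF i aut_panel[OF h i P]] hf[OF i P]] by simp
  then show "g \<otimes>\<^bsub>BijGroup \<Delta>\<^esub> h \<in> \<U> F"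
    using subgroup.m_closed[OF subgroup_aut g h] unfolding universal_group_def by blast
qed

lemma subgroup_pointwise_stabilizer:
  assumes F: "local_data I \<Omega> F" and S: "S \<subseteq> \<Delta>"
  shows "subgroup (pointwise_stabilizer (\<U> F) S) (BijGroup \<Delta>)"
proof (rule group.subgroupI[OF group_BijGroup])
  note U = subgroup_universal[OF F]
  have UB: "g \<in> Bij \<Delta>" if "g \<in> \<U> F" for g using that subgroup.subset[OF U] by auto
  show "pointwise_stabilizer (\<U> F) S \<subseteq> carrier (BijGroup \<Delta>)"
    using UB unfolding pointwise_stabilizer_def by auto
  have "\<one>\<^bsub>BijGroup \<Delta>\<^esub> \<in> pointwise_stabilizer (\<U> F) S"
    using subgroup.one_closed[OF U] S BijGroup_one_apply[of _ \<Delta>]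
    by (auto simp: pointwise_stabilizer_def)
  then show "pointwise_stabilizer (\<U> F) S \<noteq> {}" by blast
  fix g assume "g \<in> pointwise_stabilizer (\<U> F) S"
  then have g: "g \<in> \<U> F" "\<And>x. x \<in> S \<Longrightarrow> g x = x" unfolding pointwise_stabilizer_def by blast+
  have "(inv\<^bsub>BijGroup \<Delta>\<^esub> g) x = x" if "x \<in> S" for x
    using BijGroup_inv_apply_left[OF UB[OF g(1)], of x] g(2)[OF that] that S by auto
  then show "inv\<^bsub>BijGroup \<Delta>\<^esub> g \<in> pointwise_stabilizer (\<U> F) S"
    using subgroup.m_inv_closed[OF U g(1)] unfolding pointwise_stabilizer_def by blast
  fix h assume "h \<in> pointwise_stabilizer (\<U> F) S"
  then have h: "h \<in> \<U> F" "\<And>x. x \<in> S \<Longrightarrow> h x = x" unfolding pointwise_stabilizer_def by blast+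
  have "(g \<otimes>\<^bsub>BijGroup \<Delta>\<^esub> h) x = x" if "x \<in> S" for x
    using BijGroup_mult_apply[OF UB[OF g(1)] UB[OF h(1)], of x] g(2)[OF that] h(2)[OF that] that S
    by auto
  then show "g \<otimes>\<^bsub>BijGroup \<Delta>\<^esub> h \<in> pointwise_stabilizer (\<U> F) S"
    using subgroup.m_closed[OF U g(1) h(1)] unfolding pointwise_stabilizer_def by blast
qed

text \<open>
  If \<open>h\<close> fixes the images under \<open>g\<close> of all panels at which the local action of \<open>g\<close> is not in
  \<open>F\<close>, then the conjugate \<open>k\<close> of \<open>h\<close> by \<open>g\<close> fixes these panels, and hence permutes the other
  ones. At the latter the local action of \<open>k\<close> is a product of three elements of \<open>F\<close>.
\<close>

lemma conjugate_stabilizer: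
  assumes F: "local_data I \<Omega> F" and finI: "finite I"
    and "g \<in> \<G> F" and S: "finite S" "S \<subseteq> \<Delta>"
  shows "\<exists>S'. finite S' \<and> S' \<subseteq> \<Delta> \<and> (\<forall>h\<in>pointwise_stabilizer (\<U> F) S'.
    inv\<^bsub>BijGroup \<Delta>\<^esub> g \<otimes>\<^bsub>BijGroup \<Delta>\<^esub> h \<otimes>\<^bsub>BijGroup \<Delta>\<^esub> g \<in> pointwise_stabilizer (\<U> F) S)"
proof -
  interpret B: group "BijGroup \<Delta>" by (rule group_BijGroup)
  have FI: "subgroup (F i) (BijGroup (\<Omega> i))" if "i \<in> I" for i
    using F that unfolding local_data_def by blast
  have g: "g \<in> aut" and gf: "\<And>i. i \<in> I \<Longrightarrow> finite {P \<in> \<Delta> // E i. \<sigma> i g P \<notin> F i}"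
    using assms(3) unfolding almost_universal_group_def by blast+
  note gB = aut_Bij[OF g] and g' = subgroup.m_inv_closed[OF subgroup_aut g]
  define bad where "bad i = {P \<in> \<Delta> // E i. \<sigma> i g P \<notin> F i}" for i
  \<comment> \<open>The conjugate fixes a chamber \<open>x\<close> as soon as \<open>h\<close> fixes
    \<open>g x\<close>, so the chambers to be fixed by the conjugate are moved by \<open>g\<close>
    first.\<close>
  define S' where "S' = g ` (S \<union> (\<Union>i\<in>I. \<Union>(bad i)))"
  have "finite (\<Union>(bad i))" if "i \<in> I" for i
    using gf[OF that] finite_panels[OF that] unfolding bad_def by blast
  then have "finite S'" unfolding S'_def using finI S by simp
  moreover have "S' \<subseteq> \<Delta>"
    using S panel_subset Bij_mem[OF gB] unfolding S'_def bad_def by blast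
  moreover have "inv\<^bsub>BijGroup \<Delta>\<^esub> g \<otimes>\<^bsub>BijGroup \<Delta>\<^esub> h \<otimes>\<^bsub>BijGroup \<Delta>\<^esub> g \<in> pointwise_stabilizer (\<U> F) S"
    if "h \<in> pointwise_stabilizer (\<U> F) S'" for h
  proof -
    have h: "h \<in> aut" and hF: "\<And>i P. i \<in> I \<Longrightarrow> P \<in> \<Delta> // E i \<Longrightarrow> \<sigma> i h P \<in> F i"
      and hS: "\<And>x. x \<in> S' \<Longrightarrow> h x = x"
      using that unfolding pointwise_stabilizer_def universal_group_def by blast+
    note hB = aut_Bij[OF h]
    define k where "k = inv\<^bsub>BijGroup \<Delta>\<^esub> g \<otimes>\<^bsub>BijGroup \<Delta>\<^esub> h \<otimes>\<^bsub>BijGroup \<Delta>\<^esub> g"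
    have hg: "h \<otimes>\<^bsub>BijGroup \<Delta>\<^esub> g \<in> aut" by (rule subgroup.m_closed[OF subgroup_aut h g])
    have k_eq: "k = inv\<^bsub>BijGroup \<Delta>\<^esub> g \<otimes>\<^bsub>BijGroup \<Delta>\<^esub> (h \<otimes>\<^bsub>BijGroup \<Delta>\<^esub> g)"
      unfolding k_def using B.m_assoc gB hB aut_Bij[OF g'] by (metis carrier_BijGroup)
    have k: "k \<in> aut" unfolding k_eq by (rule subgroup.m_closed[OF subgroup_aut g' hg])
    note kB = aut_Bij[OF k]
    have kx: "k x = (inv\<^bsub>BijGroup \<Delta>\<^esub> g) (h (g x))" if "x \<in> \<Delta>" for x
      unfolding k_eq using BijGroup_mult_apply[OF aut_Bij[OF g'] aut_Bij[OF hg] that]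
        BijGroup_mult_apply[OF hB gB that] by simp
    have gk: "g (k x) = h (g x)" if "x \<in> \<Delta>" for x
      using BijGroup_inv_apply_right[OF gB Bij_mem[OF hB Bij_mem[OF gB that]]] kx[OF that] by simp
    have fixed: "k x = x" if "x \<in> \<Delta>" "g x \<in> S'" for x
      using kx[OF that(1)] hS[OF that(2)] BijGroup_inv_apply_left[OF gB that(1)] by simp
    have "\<sigma> i k P \<in> F i" if i: "i \<in> I" and P: "P \<in> \<Delta> // E i" for i P
    proof -
      have kP: "k ` P \<in> \<Delta> // E i" by (rule aut_panel[OF k i P])
      have bad_fix: "k x = x" if "Q \<in> bad i" "x \<in> Q" for Q x
      proof (rule fixed)
        show "x \<in> \<Delta>" using that panel_subset[OF i] unfolding bad_def by blast
        show "g x \<in> S'" using that i unfolding S'_def by blast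
      qed
      have "\<one>\<^bsub>BijGroup (\<Omega> i)\<^esub> \<in> F i" by (rule subgroup.one_closed[OF FI[OF i]])
      moreover have "\<sigma> i k P = \<one>\<^bsub>BijGroup (\<Omega> i)\<^esub>" if "P \<in> bad i"
        using bad_fix[OF that] by (rule local_action_fix[OF i P])
      \<comment> \<open>Since \<open>k\<close> fixes the image panel pointwise,
        \<open>k (k x) = k x\<close>, and injectivity gives \<open>k x = x\<close>.\<close>
      moreover have "\<sigma> i k P = \<one>\<^bsub>BijGroup (\<Omega> i)\<^esub>" if "k ` P \<in> bad i"
      proof (rule local_action_fix[OF i P])
        fix x assume "x \<in> P"
        then have "k (k x) = k x" "x \<in> \<Delta>" using bad_fix[OF that] panel_subset[OF i P] by blast+
        then show "k x = x" using Bij_inj[OF kB] Bij_mem[OF kB] by metis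
      qed
      moreover have "\<sigma> i k P \<in> F i" if "P \<notin> bad i" "k ` P \<notin> bad i"
      proof -
        \<comment> \<open>The inverse of \<open>g\<close> is applied at the panel reached by
          \<open>h g\<close>. Writing this panel as the \<open>g\<close>-image of \<open>k\<close>
          P\<open>turns its local action into the inverse of that of\<close>g\<open>at\<close>k
          \<open>P\<close>, which is not singular.\<close>
        have "(h \<otimes>\<^bsub>BijGroup \<Delta>\<^esub> g) ` P = g ` k ` P"
          unfolding image_image
        proof (rule image_cong[OF HOL.refl])
          fix x assume "x \<in> P"
          then have "x \<in> \<Delta>" using panel_subset[OF i P] by blast
          then show "(h \<otimes>\<^bsub>BijGroup \<Delta>\<^esub> g) x = g (k x)"
            using gk BijGroup_mult_apply[OF hB gB] by simp
        qed
        then have "\<sigma> i k P = \<sigma> i (inv\<^bsub>BijGroup \<Delta>\<^esub> g) (g ` k ` P) \<otimes>\<^bsub>BijGroup (\<Omega> i)\<^esub>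
            \<sigma> i (h \<otimes>\<^bsub>BijGroup \<Delta>\<^esub> g) P"
          unfolding k_eq using local_action_mult[OF g' hg i P] by simp
        then have "\<sigma> i k P = (inv\<^bsub>BijGroup (\<Omega> i)\<^esub> \<sigma> i g (k ` P)) \<otimes>\<^bsub>BijGroup (\<Omega> i)\<^esub>
            (\<sigma> i h (g ` P) \<otimes>\<^bsub>BijGroup (\<Omega> i)\<^esub> \<sigma> i g P)"
          using local_action_inv[OF g i kP] local_action_mult[OF h g i P] by simp
        moreover have "\<sigma> i g P \<in> F i" "\<sigma> i g (k ` P) \<in> F i"
          using that P kP unfolding bad_def by blast+
        ultimately show ?thesis
          using hF[OF i aut_panel[OF g i P]] FI[OF i]
          by (simp add: subgroup.m_closed subgroup.m_inv_closed)
      qed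
      ultimately show ?thesis by metis
    qed
    moreover have "k x = x" if "x \<in> S" for x
      using fixed that S(2) unfolding S'_def by blast
    ultimately show ?thesis
      using k unfolding k_def[symmetric] pointwise_stabilizer_def universal_group_def by blast
  qed
  ultimately show ?thesis by blast
qed

end

section \<open>Compactness of chamber stabilizers\<close>

lemma coxeter_rel_lists: "(u, v) \<in> coxeter_rel I m \<Longrightarrow> u \<in> lists I \<and> v \<in> lists I"
proof (induction rule: coxeter_rel.induct)
  case (relator u v i j k)
  then have "concat (replicate k [i, j]) \<in> lists I" by (auto simp: in_lists_conv_set)
  then show ?case using relator by simp
qed auto

text \<open>The distance is tied to galleries only through reduced words, while its value is merely
  the class of some word \<open>u\<close>. A shortest word of that class is reduced and is therefore
  the type of a gallery.\<close>

lemma building_connected: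
  assumes B: "building I m \<Delta> E" and x: "x \<in> \<Delta>" and y: "y \<in> \<Delta>"
  shows "\<exists>f\<in>lists I. joined_by_gallery E f x y"
proof -
  obtain \<delta> where
    car: "\<forall>x\<in>\<Delta>. \<forall>y\<in>\<Delta>. \<delta> x y \<in> carrier (coxeter_group I m)" and
    red: "\<forall>f. reduced_word I m f \<longrightarrow> (\<forall>x\<in>\<Delta>. \<forall>y\<in>\<Delta>.
      \<delta> x y = coxeter_rel I m `` {f} \<longleftrightarrow> joined_by_gallery E f x y)"
    using B unfolding building_def by (elim conjE exE)
  have "\<delta> x y \<in> lists I // coxeter_rel I m"
    using car x y unfolding coxeter_group_def by simp
  then obtain u where u: "u \<in> lists I" "\<delta> x y = coxeter_rel I m `` {u}"
    by (rule quotientE)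
  obtain f where f: "(u, f) \<in> coxeter_rel I m"
    and min: "\<And>g. (u, g) \<in> coxeter_rel I m \<Longrightarrow> length f \<le> length g"
    using ex_has_least_nat[of "\<lambda>f. (u, f) \<in> coxeter_rel I m" u length] coxeter_rel.refl[OF u(1)]
    by metis
  have "coxeter_rel I m `` {u} = coxeter_rel I m `` {f}"
  proof (intro equalityI subsetI)
    fix v assume "v \<in> coxeter_rel I m `` {u}"
    then have "(u, v) \<in> coxeter_rel I m" by simp
    then show "v \<in> coxeter_rel I m `` {f}"
      using coxeter_rel.trans[OF coxeter_rel.sym[OF f]] by simp
  next
    fix v assume "v \<in> coxeter_rel I m `` {f}"
    then have "(f, v) \<in> coxeter_rel I m" by simp
    then show "v \<in> coxeter_rel I m `` {u}"
      using coxeter_rel.trans[OF f] by simp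
  qed
  moreover have f_lists: "f \<in> lists I" using coxeter_rel_lists[OF f] by simp
  moreover have "reduced_word I m f"
    unfolding reduced_word_def using f_lists min coxeter_rel.trans[OF f] by simp
  ultimately show ?thesis using red x y u(2) by metis
qed

section \<open>Galleries and pointwise limits of automorphisms\<close>

context legally_colored
begin

text \<open>Connectedness in the form needed for surjectivity: \<open>A\<close> will be the image of
  a pointwise limit.\<close>

lemma gallery_in_closed:
  assumes "\<And>i x y. i \<in> I \<Longrightarrow> x \<in> A \<Longrightarrow> (x, y) \<in> E i \<Longrightarrow> y \<in> A"
  shows "w \<in> lists I \<Longrightarrow> joined_by_gallery E w x y \<Longrightarrow> x \<in> A \<Longrightarrow> y \<in> A"
proof (induction w arbitrary: x)
  case (Cons i w)
  then obtain z where "(x, z) \<in> E i" "joined_by_gallery E w z y" by auto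
  moreover have "z \<in> A" using assms[of i x z] calculation Cons.prems by simp
  ultimately show ?case using Cons by simp
qed simp

text \<open>Injectivity keeps consecutive chambers distinct. An automorphism fixing \<open>x\<close>
  thus moves \<open>y\<close> only among the ends of galleries of type \<open>w\<close> from
  \<open>x\<close>, a finite set by \<open>finite_galleries\<close>.\<close>

lemma gallery_aut:
  assumes g: "g \<in> aut"
  shows "w \<in> lists I \<Longrightarrow> joined_by_gallery E w x y \<Longrightarrow> x \<in> \<Delta> \<Longrightarrow> joined_by_gallery E w (g x) (g y)"
proof (induction w arbitrary: x)
  case (Cons i w)
  then obtain z where z: "(x, z) \<in> E i" "x \<noteq> z" "joined_by_gallery E w z y" by auto
  have i: "i \<in> I" using Cons.prems by simp
  then have "z \<in> \<Delta>" using edge_chambers z(1) by blast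
  then have "(g x, g z) \<in> E i" "g x \<noteq> g z" "joined_by_gallery E w (g z) (g y)"
    using aut_edge[OF g i] Bij_inj[OF aut_Bij[OF g]] Cons z by simp_all
  then show ?case by auto
qed simp

lemma finite_galleries:
  "w \<in> lists I \<Longrightarrow> x \<in> \<Delta> \<Longrightarrow> finite {y. joined_by_gallery E w x y}"
proof (induction w arbitrary: x)
  case Nil
  have "{y. joined_by_gallery E [] x y} = {x}" by auto
  then show ?case by simp
next
  case (Cons i w)
  have i: "i \<in> I" using Cons.prems by simp
  have "finite (E i `` {x})" using finite_panels[OF i] panel_of[OF i Cons.prems(2)] by simp
  moreover have "finite {y. joined_by_gallery E w z y}" if "z \<in> E i `` {x}" for z
    using Cons.IH Cons.prems(1) edge_chambers[OF i] that by simp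
  ultimately have "finite (\<Union>z\<in>E i `` {x}. {y. joined_by_gallery E w z y})" by simp
  then show ?case by (rule rev_finite_subset) auto
qed

text \<open>
  Surjectivity is the one condition which does not pass to pointwise limits in general. Here it
  does: finite panels are mapped onto panels, so the image is closed under adjacency.
\<close>

lemma stabilizer_pointwise_closed:
  assumes conn: "\<And>y. y \<in> \<Delta> \<Longrightarrow> \<exists>w\<in>lists I. joined_by_gallery E w x\<^sub>0 y"
    and x\<^sub>0: "x\<^sub>0 \<in> \<Delta>"
    and ext: "f \<in> extensional \<Delta>"
    and approx: "\<And>S. finite S \<Longrightarrow> S \<subseteq> \<Delta> \<Longrightarrow>
      \<exists>h\<in>pointwise_stabilizer (\<U> F) {x\<^sub>0}. \<forall>s\<in>S. h s = f s"
  shows "f \<in> pointwise_stabilizer (\<U> F) {x\<^sub>0}"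
proof -
  have approx': "\<exists>h. h \<in> aut \<and> (\<forall>i\<in>I. \<forall>P\<in>\<Delta> // E i. \<sigma> i h P \<in> F i) \<and> h x\<^sub>0 = x\<^sub>0 \<and> (\<forall>s\<in>S. h s = f s)"
    if "finite S" "S \<subseteq> \<Delta>" for S
    using approx[OF that] unfolding pointwise_stabilizer_def universal_group_def by auto
  have fx: "f x\<^sub>0 = x\<^sub>0" using approx'[of "{x\<^sub>0}"] x\<^sub>0 by auto
  \<comment> \<open>Each of these conditions involves only two chambers, so it is inherited from an
    approximant agreeing with \<open>f\<close> on this pair.\<close>
  have two: "f y \<in> \<Delta> \<and> (f y = f z \<longleftrightarrow> y = z) \<and> (\<forall>i\<in>I. (y, z) \<in> E i \<longleftrightarrow> (f y, f z) \<in> E i)"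
    if "y \<in> \<Delta>" "z \<in> \<Delta>" for y z
  proof -
    have "finite {y, z}" "{y, z} \<subseteq> \<Delta>" using that by simp_all
    from approx'[OF this] obtain h where h: "h \<in> aut" "h y = f y" "h z = f z" by auto
    then show ?thesis
      using aut_edge[OF h(1)] Bij_mem[OF aut_Bij[OF h(1)]] Bij_inj[OF aut_Bij[OF h(1)]] that
      by metis
  qed
  \<comment> \<open>Because panels are finite, one approximant agrees with \<open>f\<close> on all
    of \<open>P\<close>.\<close>
  have panel: "f ` P \<in> \<Delta> // E i \<and> \<sigma> i f P \<in> F i" if i: "i \<in> I" and P: "P \<in> \<Delta> // E i" for i P
  proof -
    obtain h where h: "h \<in> aut" "\<sigma> i h P \<in> F i" "\<forall>s\<in>P. h s = f s"
      using approx'[OF finite_panels[OF i P] panel_subset[OF i P]] i P by blast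
    have "f ` P = h ` P" using h(3) by (intro image_cong) auto
    moreover have "\<sigma> i f P = \<sigma> i h P" using h(3) by (intro local_action_cong[OF i P]) simp
    ultimately show ?thesis using aut_panel[OF h(1) i P] h(2) by simp
  qed
  have closed: "y \<in> f ` \<Delta>" if i: "i \<in> I" and x: "x \<in> f ` \<Delta>" and xy: "(x, y) \<in> E i" for i x y
  proof -
    obtain z where z: "z \<in> \<Delta>" "x = f z" using x by blast
    have P: "E i `` {z} \<in> \<Delta> // E i" "z \<in> E i `` {z}" using panel_of[OF i z(1)] by blast+
    \<comment> \<open>The image is a panel containing \<open>x\<close>, hence the whole panel of
      \<open>x\<close>, which contains \<open>y\<close>.\<close>
    have "f ` (E i `` {z}) = E i `` {x}"
      using panel_mem_eq[OF i] panel[OF i P(1)] P(2) z(2) by blast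
    then have "y \<in> f ` (E i `` {z})" using xy by blast
    then show ?thesis using panel_subset[OF i P(1)] by blast
  qed
  have "\<Delta> \<subseteq> f ` \<Delta>"
  proof
    fix y assume "y \<in> \<Delta>"
    then obtain w where w: "w \<in> lists I" "joined_by_gallery E w x\<^sub>0 y" using conn by blast
    have "x\<^sub>0 \<in> f ` \<Delta>" using fx x\<^sub>0 by force
    with closed w show "y \<in> f ` \<Delta>" by (rule gallery_in_closed)
  qed
  moreover have "f ` \<Delta> \<subseteq> \<Delta>" using two by blast
  moreover have "inj_on f \<Delta>" using two by (simp add: inj_on_def)
  ultimately have "f \<in> Bij \<Delta>" using ext unfolding Bij_def bij_betw_def by blast
  then show ?thesis
    using fx two panel unfolding pointwise_stabilizer_def universal_group_def building_aut_def
    by simp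
qed

end

section \<open>The topology of the restricted universal group\<close>

lemma l_coset_carrier_update: "x <#\<^bsub>G\<lparr>carrier := H\<rparr>\<^esub> S = x <#\<^bsub>G\<^esub> S"
  by (simp add: l_coset_def)

text \<open>In this locale \<open>'a\<close> is the type of indices and \<open>'c\<close> that of
  colors, so \<open>F i\<close> consists of permutations of colors.\<close>

locale restricted_universal = legally_colored +
  fixes F F' :: "'a \<Rightarrow> ('c \<Rightarrow> 'c) set"
  assumes local_data: "local_data I \<Omega> F" and local_data': "local_data I \<Omega> F'"
    and le: "i \<in> I \<Longrightarrow> F i \<subseteq> F' i"
    and finite_I: "finite I"
begin

abbreviation "H \<equiv> restricted_universal_group I \<Delta> E \<Omega> col F F'"
abbreviation "\<N> \<equiv> {pointwise_stabilizer (\<U> F) S |S. finite S \<and> S \<subseteq> \<Delta>}"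

lemma subgroup_H: "subgroup (\<G> F \<inter> \<U> F') (BijGroup \<Delta>)"
  by (intro group.subgroups_Inter_pair group_BijGroup subgroup_almost_universal
      subgroup_universal local_data local_data')

lemma U_subset_H: "\<U> F \<subseteq> carrier H"
proof
  fix g assume "g \<in> \<U> F"
  then have g: "g \<in> aut" "\<And>i P. i \<in> I \<Longrightarrow> P \<in> \<Delta> // E i \<Longrightarrow> \<sigma> i g P \<in> F i"
    unfolding universal_group_def by blast+
  have "finite {P \<in> \<Delta> // E i. \<sigma> i g P \<notin> F i}" if "i \<in> I" for i
    using g(2)[OF that] not_finite_existsD by blast
  moreover have "\<sigma> i g P \<in> F' i" if "i \<in> I" "P \<in> \<Delta> // E i" for i P
    using g(2)[OF that] le[OF that(1)] by blast
  ultimately show "g \<in> carrier H"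
    using g(1)
    by (simp add: restricted_universal_group_def almost_universal_group_def universal_group_def)
qed

lemma H_Bij: "g \<in> carrier H \<Longrightarrow> g \<in> Bij \<Delta>"
  using subgroup.subset[OF subgroup_H] by (auto simp: restricted_universal_group_def)

lemma H_inv: "g \<in> carrier H \<Longrightarrow> inv\<^bsub>H\<^esub> g = inv\<^bsub>BijGroup \<Delta>\<^esub> g"
  using group.m_inv_consistent[OF group_BijGroup subgroup_H]
  by (simp add: restricted_universal_group_def)

lemma H_mult: "g \<otimes>\<^bsub>H\<^esub> h = g \<otimes>\<^bsub>BijGroup \<Delta>\<^esub> h"
  by (simp add: restricted_universal_group_def)

lemma H_l_coset: "g <#\<^bsub>H\<^esub> S = g <#\<^bsub>BijGroup \<Delta>\<^esub> S"
  by (simp add: restricted_universal_group_def l_coset_carrier_update)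

text \<open>Directedness comes from unions of finite sets of chambers; the conjugation axiom is
  \<open>conjugate_stabilizer\<close>, read inside \<open>H\<close>.\<close>

sublocale subgroup_base H \<N>
proof (intro subgroup_base.intro subgroup_base_axioms.intro)
  show gH: "group H"
    using subgroup.subgroup_is_group[OF subgroup_H group_BijGroup]
    by (simp add: restricted_universal_group_def)
  show "subgroup N H" if "N \<in> \<N>" for N
  proof -
    from that obtain S where S: "N = pointwise_stabilizer (\<U> F) S" "S \<subseteq> \<Delta>" by blast
    have "N \<subseteq> \<G> F \<inter> \<U> F'"
      using U_subset_H unfolding S(1) pointwise_stabilizer_def
      by (auto simp: restricted_universal_group_def)
    then show ?thesis
      using group.subgroup_incl[OF group_BijGroup _ subgroup_H]
        subgroup_pointwise_stabilizer[OF local_data S(2)]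
      unfolding S(1) restricted_universal_group_def by blast
  qed
  show "\<N> \<noteq> {}" by blast
  show "\<exists>M\<in>\<N>. M \<subseteq> N \<inter> N'" if "N \<in> \<N>" "N' \<in> \<N>" for N N'
  proof -
    from that obtain S S' where S: "N = pointwise_stabilizer (\<U> F) S" "finite S" "S \<subseteq> \<Delta>"
      "N' = pointwise_stabilizer (\<U> F) S'" "finite S'" "S' \<subseteq> \<Delta>"
      by blast
    then have "pointwise_stabilizer (\<U> F) (S \<union> S') \<subseteq> N \<inter> N'"
      unfolding pointwise_stabilizer_def by blast
    moreover have "finite (S \<union> S')" "S \<union> S' \<subseteq> \<Delta>" using S by simp_all
    ultimately show ?thesis by blast
  qed
  show "\<exists>M\<in>\<N>. \<forall>x\<in>M. inv\<^bsub>H\<^esub> g \<otimes>\<^bsub>H\<^esub> x \<otimes>\<^bsub>H\<^esub> g \<in> N" if g: "g \<in> carrier H" and N: "N \<in> \<N>" for g N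
  proof -
    obtain S where S: "N = pointwise_stabilizer (\<U> F) S" "finite S" "S \<subseteq> \<Delta>" using N by blast
    have "g \<in> \<G> F" using g by (simp add: restricted_universal_group_def)
    then obtain S' where "finite S'" "S' \<subseteq> \<Delta>" and
      "\<forall>x\<in>pointwise_stabilizer (\<U> F) S'.
        inv\<^bsub>BijGroup \<Delta>\<^esub> g \<otimes>\<^bsub>BijGroup \<Delta>\<^esub> x \<otimes>\<^bsub>BijGroup \<Delta>\<^esub> g \<in> N"
      using conjugate_stabilizer[OF local_data finite_I _ S(2,3)] S(1) by metis
    then show ?thesis unfolding H_inv[OF g] H_mult by blast
  qed
qed

lemma stabilizer_mem: "finite S \<Longrightarrow> S \<subseteq> \<Delta> \<Longrightarrow> pointwise_stabilizer (\<U> F) S \<in> \<N>"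
  by blast

text \<open>Both topologies test openness with the same cosets of the same stabilizers in
  \<open>\<U> F\<close>. Continuity and openness of the inclusion follow once \<open>\<U> F\<close>
  is seen to be open.\<close>

lemma openin_permutation_iff:
  "openin (permutation_topology \<Delta> (\<U> F)) V \<longleftrightarrow> V \<subseteq> \<U> F \<and> openin coset_topology V"
proof -
  have "(\<exists>N\<in>\<N>. Q N) \<longleftrightarrow> (\<exists>S. finite S \<and> S \<subseteq> \<Delta> \<and> Q (pointwise_stabilizer (\<U> F) S))" for Q
    by blast
  then show ?thesis
    unfolding openin_permutation_topology openin_coset_topology H_l_coset
    using U_subset_H by simp blast
qed

lemma openin_stabilizer:
  assumes "finite S" and "S \<subseteq> \<Delta>"
  shows "openin coset_topology (pointwise_stabilizer (\<U> F) S)"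
proof -
  have "\<one>\<^bsub>H\<^esub> <#\<^bsub>H\<^esub> pointwise_stabilizer (\<U> F) S = pointwise_stabilizer (\<U> F) S"
    using lcos_mult_one subgroup.subset[OF subgroup_mem[OF stabilizer_mem[OF assms]]] by blast
  then show ?thesis using openin_l_coset[OF stabilizer_mem[OF assms] one_closed] by simp
qed

lemma topspace_permutation_topology: "topspace (permutation_topology \<Delta> (\<U> F)) = \<U> F"
proof -
  \<comment> \<open>The empty set of chambers makes \<open>\<U> F\<close> itself a member of the
    base.\<close>
  have "pointwise_stabilizer (\<U> F) {} = \<U> F" by (simp add: pointwise_stabilizer_def)
  then have "openin (permutation_topology \<Delta> (\<U> F)) (\<U> F)"
    using openin_stabilizer[of "{}"] by (simp add: openin_permutation_iff)
  then show ?thesis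
    by (meson openin_permutation_iff openin_subset openin_topspace subset_antisym)
qed

text \<open>For uniqueness, each property of the inclusion yields one half of the comparison at the
  identity: openness makes the stabilizers open in \<open>T\<close>, and continuity puts a
  stabilizer inside every \<open>T\<close>-neighbourhood of \<open>\<one>\<close>.\<close>

lemma restricted_topology_eq: "restricted_topology I \<Delta> E \<Omega> col F F' = coset_topology"
  unfolding restricted_topology_def
proof (rule the_equality)
  let ?P = "permutation_topology \<Delta> (\<U> F)"
  have "continuous_map ?P coset_topology (\<lambda>g. g)"
    unfolding continuous_map_def
  proof (intro conjI allI impI)
    show "(\<lambda>g. g) \<in> topspace ?P \<rightarrow> topspace coset_topology"
      using U_subset_H by (auto simp: topspace_permutation_topology topspace_coset_topology)
    fix V assume V: "openin coset_topology V"
    have "{x \<in> topspace ?P. x \<in> V} = \<U> F \<inter> V"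
      by (auto simp: topspace_permutation_topology)
    moreover have "openin coset_topology (\<U> F)"
      using openin_topspace[of ?P] by (simp add: topspace_permutation_topology openin_permutation_iff)
    ultimately show "openin ?P {x \<in> topspace ?P. x \<in> V}"
      using V by (simp add: openin_permutation_iff openin_Int)
  qed
  moreover have "open_map ?P coset_topology (\<lambda>g. g)"
    unfolding open_map_def by (simp add: openin_permutation_iff)
  ultimately show "topological_group H coset_topology \<and> continuous_map ?P coset_topology (\<lambda>g. g) \<and>
      open_map ?P coset_topology (\<lambda>g. g)"
    using topological_group_coset_topology by blast
  fix T
  assume T: "topological_group H T \<and> continuous_map ?P T (\<lambda>g. g) \<and> open_map ?P T (\<lambda>g. g)"
  show "T = coset_topology"
  proof (rule coset_topology_unique)
    show "topological_group H T" using T by blast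
    fix N assume "N \<in> \<N>"
    then obtain S where S: "N = pointwise_stabilizer (\<U> F) S" "finite S" "S \<subseteq> \<Delta>" by blast
    have "openin ?P N"
      using openin_stabilizer[OF S(2,3)] unfolding openin_permutation_iff S(1)
      by (auto simp: pointwise_stabilizer_def)
    then have "openin T ((\<lambda>g. g) ` N)" using T unfolding open_map_def by blast
    then show "openin T N" by simp
  next
    fix V assume V: "openin T V" "\<one>\<^bsub>H\<^esub> \<in> V"
    have "openin ?P {x \<in> topspace ?P. x \<in> V}"
      using T openin_continuous_map_preimage[OF _ V(1)] by blast
    then have "openin coset_topology {x \<in> \<U> F. x \<in> V}"
      by (simp add: topspace_permutation_topology openin_permutation_iff)
    moreover have "\<one>\<^bsub>H\<^esub> \<in> \<U> F"
      using subgroup.one_closed[OF subgroup_universal[OF local_data]]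
      by (simp add: restricted_universal_group_def)
    ultimately obtain N where N: "N \<in> \<N>" "\<one>\<^bsub>H\<^esub> <#\<^bsub>H\<^esub> N \<subseteq> {x \<in> \<U> F. x \<in> V}"
      using V(2) unfolding openin_coset_topology by blast
    moreover have "\<one>\<^bsub>H\<^esub> <#\<^bsub>H\<^esub> N = N"
      using lcos_mult_one subgroup.subset[OF subgroup_mem[OF N(1)]] by blast
    ultimately show "\<exists>N\<in>\<N>. N \<subseteq> V" by auto
  qed
qed

text \<open>Right multiplication by an element fixing \<open>c\<close> does not change the value at
  \<open>c\<close>, so evaluation at \<open>c\<close> is locally constant. As \<open>Q\<close> is
  arbitrary, the complement is open too, so these sets are clopen.\<close>

lemma openin_value:
  assumes c: "c \<in> \<Delta>"
  shows "openin coset_topology {k \<in> carrier H. Q (k c)}"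
  unfolding openin_coset_topology
proof (intro conjI ballI)
  fix g assume g: "g \<in> {k \<in> carrier H. Q (k c)}"
  let ?N = "pointwise_stabilizer (\<U> F) {c}"
  have N: "?N \<in> \<N>" using stabilizer_mem[of "{c}"] c by simp
  have "g \<otimes>\<^bsub>H\<^esub> n \<in> {k \<in> carrier H. Q (k c)}" if "n \<in> ?N" for n
  proof -
    have n: "n \<in> carrier H" "n c = c"
      using that U_subset_H unfolding pointwise_stabilizer_def by blast+
    have "(g \<otimes>\<^bsub>H\<^esub> n) c = g c"
      using g n BijGroup_mult_apply[OF H_Bij H_Bij c] by (simp add: H_mult)
    then show ?thesis using g n(1) by simp
  qed
  then have "g <#\<^bsub>H\<^esub> ?N \<subseteq> {k \<in> carrier H. Q (k c)}" unfolding l_coset_def by blast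
  then show "\<exists>N\<in>\<N>. g <#\<^bsub>H\<^esub> N \<subseteq> {k \<in> carrier H. Q (k c)}" using N by blast
qed blast

lemma separating_chamber:
  assumes "g \<in> carrier H" and "h \<in> carrier H" and "g \<noteq> h"
  obtains c where "c \<in> \<Delta>" and "g c \<noteq> h c"
  using Bij_eqI[OF H_Bij[OF assms(1)] H_Bij[OF assms(2)]] assms(3) by blast

lemma Hausdorff_coset_topology: "Hausdorff_space coset_topology"
  unfolding Hausdorff_space_def topspace_coset_topology
proof (intro allI impI, elim conjE)
  fix g h assume gh: "g \<in> carrier H" "h \<in> carrier H" "g \<noteq> h"
  then obtain c where c: "c \<in> \<Delta>" "g c \<noteq> h c" by (rule separating_chamber)
  let ?U = "\<lambda>g. {k \<in> carrier H. k c = g c}"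
  have "openin coset_topology (?U g)" "openin coset_topology (?U h)"
    using openin_value[OF c(1), of "\<lambda>d. d = g c"] openin_value[OF c(1), of "\<lambda>d. d = h c"]
    by simp_all
  moreover have "g \<in> ?U g" "h \<in> ?U h" using gh by simp_all
  moreover have "disjnt (?U g) (?U h)" using c(2) by (auto simp: disjnt_def)
  ultimately show "\<exists>U V. openin coset_topology U \<and> openin coset_topology V \<and> g \<in> U \<and> h \<in> V \<and>
      disjnt U V" by blast
qed

lemma totally_disconnected_coset_topology: "totally_disconnected_space coset_topology"
  unfolding totally_disconnected_space_def topspace_coset_topology
proof
  fix g assume g: "g \<in> carrier H"
  have "h = g" if h: "connected_component_of coset_topology g h" for h
  proof (rule ccontr)
    assume "h \<noteq> g"
    obtain T where T: "connectedin coset_topology T" "g \<in> T" "h \<in> T"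
      using h unfolding connected_component_of_def by blast
    then have "h \<in> carrier H"
      using connectedin_subset_topspace topspace_coset_topology by blast
    then obtain c where c: "c \<in> \<Delta>" "g c \<noteq> h c"
      using separating_chamber[OF g] \<open>h \<noteq> g\<close> by metis
    let ?U = "{k \<in> carrier H. k c = g c}"
    have "openin coset_topology ?U"
      using openin_value[OF c(1), of "\<lambda>d. d = g c"] by simp
    moreover have "closedin coset_topology ?U"
    proof -
      have "carrier H - ?U = {k \<in> carrier H. k c \<noteq> g c}" by blast
      then show ?thesis
        unfolding closedin_def topspace_coset_topology
        using openin_value[OF c(1), of "\<lambda>d. d \<noteq> g c"] by auto
    qed
    ultimately have "T \<subseteq> ?U \<or> disjnt T ?U"
      by (intro connectedin_clopen_cases[OF T(1)])
    moreover have "g \<in> ?U" using g by simp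
    ultimately show False using T(2,3) c(2) by (auto simp: disjnt_iff)
  qed
  moreover have "connected_component_of coset_topology g g"
    using g by (simp add: connected_component_of_refl topspace_coset_topology)
  ultimately show "connected_component_of_set coset_topology g = {g}" by blast
qed

lemma compactin_chamber_stabilizer:
  assumes x\<^sub>0: "x\<^sub>0 \<in> \<Delta>"
    and conn: "\<And>y. y \<in> \<Delta> \<Longrightarrow> \<exists>w\<in>lists I. joined_by_gallery E w x\<^sub>0 y"
  shows "compactin coset_topology (pointwise_stabilizer (\<U> F) {x\<^sub>0})"
proof -
  let ?K = "pointwise_stabilizer (\<U> F) {x\<^sub>0}"
  obtain w where w: "\<And>y. y \<in> \<Delta> \<Longrightarrow> w y \<in> lists I \<and> joined_by_gallery E (w y) x\<^sub>0 y"
    using conn by metis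
  \<comment> \<open>A gallery type \<open>w c\<close> from \<open>x\<^sub>0\<close> to
    \<open>c\<close> is chosen once for each \<open>c\<close>. The stabilizer preserves both
    \<open>x\<^sub>0\<close> and gallery types, so \<open>X c\<close> is a finite set containing the
    orbit of \<open>c\<close>.\<close>
  define X where "X c = {d. joined_by_gallery E (w c) x\<^sub>0 d}" for c
  have KH: "?K \<subseteq> carrier H" using U_subset_H unfolding pointwise_stabilizer_def by blast
  show ?thesis
  proof (rule compactin_pointwise[where D = \<Delta> and X = X])
    show "finite (X c)" if "c \<in> \<Delta>" for c
      unfolding X_def using finite_galleries w[OF that] x\<^sub>0 by blast
    show "?K \<subseteq> PiE \<Delta> X"
    proof
      fix h assume h: "h \<in> ?K"
      then have "h \<in> aut" "h x\<^sub>0 = x\<^sub>0"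
        unfolding pointwise_stabilizer_def universal_group_def by blast+
      then have "h c \<in> X c" if "c \<in> \<Delta>" for c
        unfolding X_def using gallery_aut[of h "w c" x\<^sub>0 c] w[OF that] x\<^sub>0 by simp
      moreover have "h \<in> extensional \<Delta>" using Bij_imp_extensional[OF aut_Bij[OF \<open>h \<in> aut\<close>]] .
      ultimately show "h \<in> PiE \<Delta> X" by (simp add: PiE_iff)
    qed
    show "?K \<subseteq> topspace coset_topology" using KH by (simp add: topspace_coset_topology)
    show "\<exists>S. finite S \<and> S \<subseteq> \<Delta> \<and> (\<forall>h\<in>?K. \<exists>s\<in>S. h s \<noteq> f s)" if f: "f \<in> PiE \<Delta> X - ?K" for f
    proof (rule ccontr)
      \<comment> \<open>If no finite set of chambers separates \<open>f\<close> from the stabilizer,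
        then \<open>f\<close> is a pointwise limit of its elements and so belongs to it.\<close>
      assume no: "\<not> ?thesis"
      have "f \<in> ?K"
      proof (rule stabilizer_pointwise_closed[OF conn x\<^sub>0])
        show "f \<in> extensional \<Delta>" using f by (simp add: PiE_iff)
        show "\<exists>h\<in>?K. \<forall>s\<in>S. h s = f s" if "finite S" "S \<subseteq> \<Delta>" for S
          using no that by metis
      qed
      then show False using f by simp
    qed
    show "\<exists>S. finite S \<and> S \<subseteq> \<Delta> \<and> (\<forall>h\<in>?K. (\<forall>s\<in>S. h s = g s) \<longrightarrow> h \<in> V)"
      if V: "openin coset_topology V" and g: "g \<in> V \<inter> ?K" for V g
    proof -
      obtain N where "N \<in> \<N>" "g <#\<^bsub>H\<^esub> N \<subseteq> V"
        using V g unfolding openin_coset_topology by blast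
      then obtain S where S: "finite S" "S \<subseteq> \<Delta>" "g <#\<^bsub>H\<^esub> pointwise_stabilizer (\<U> F) S \<subseteq> V"
        by blast
      have "h \<in> V" if h: "h \<in> ?K" "\<forall>s\<in>S. h s = g s" for h
      proof -
        interpret U: subgroup "\<U> F" "BijGroup \<Delta>" by (rule subgroup_universal[OF local_data])
        have gh: "g \<in> \<U> F" "h \<in> \<U> F" using g h unfolding pointwise_stabilizer_def by blast+
        then have ghH: "g \<in> carrier H" "h \<in> carrier H" using U_subset_H by blast+
        \<comment> \<open>Agreement of \<open>g\<close> and \<open>h\<close> on \<open>S\<close>
          means that \<open>?n\<close> fixes \<open>S\<close>, so \<open>h\<close> lies in the coset
          of \<open>g\<close> contained in \<open>V\<close>.\<close>
        let ?n = "inv\<^bsub>BijGroup \<Delta>\<^esub> g \<otimes>\<^bsub>BijGroup \<Delta>\<^esub> h"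
        have "?n s = s" if "s \<in> S" for s
        proof -
          have s: "s \<in> \<Delta>" using that S(2) by blast
          have "?n s = (inv\<^bsub>BijGroup \<Delta>\<^esub> g) (h s)"
            by (rule BijGroup_mult_apply[OF BijGroup_inv_Bij[OF H_Bij[OF ghH(1)]] H_Bij[OF ghH(2)] s])
          then show ?thesis using h(2) that BijGroup_inv_apply_left[OF H_Bij[OF ghH(1)] s] by simp
        qed
        moreover have "?n \<in> \<U> F" using gh by blast
        ultimately have "?n \<in> pointwise_stabilizer (\<U> F) S" unfolding pointwise_stabilizer_def by blast
        moreover have "g \<otimes>\<^bsub>H\<^esub> ?n = h"
          unfolding H_inv[OF ghH(1), symmetric] H_mult[symmetric]
          using ghH by (simp add: m_assoc[symmetric])
        ultimately have "h \<in> g <#\<^bsub>H\<^esub> pointwise_stabilizer (\<U> F) S" unfolding l_coset_def by blast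
        then show "h \<in> V" using S(3) by blast
      qed
      then show ?thesis using S(1,2) by blast
    qed
  qed
qed

end

theorem proposition6p4:
  fixes I :: "'i set"
    and m :: "'i \<Rightarrow> 'i \<Rightarrow> enat"
    and \<Delta> :: "'c set"
    and E :: "'i \<Rightarrow> ('c \<times> 'c) set"
    and q :: "'i \<Rightarrow> nat"
    and \<Omega> :: "'i \<Rightarrow> 'a set"
    and col :: "'i \<Rightarrow> 'c \<Rightarrow> 'a"
    and F F' :: "'i \<Rightarrow> ('a \<Rightarrow> 'a) set"
  assumes "finite I"
    and "right_angled I m"
    and "building I m \<Delta> E"
    and "locally_finite_semiregular I \<Delta> E q"
    and "\<forall>i\<in>I. finite (\<Omega> i) \<and> card (\<Omega> i) = q i"
    and "legal_coloring I \<Delta> E \<Omega> col"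
    and "local_data I \<Omega> F"
    and "local_data I \<Omega> F'"
    and "\<forall>i\<in>I. F i \<subseteq> F' i \<and> F' i \<subseteq> young_overgroup (\<Omega> i) (F i)"
  shows "tdlc_group (restricted_universal_group I \<Delta> E \<Omega> col F F')
           (restricted_topology I \<Delta> E \<Omega> col F F')"
proof -
  have cs: "chamber_system I \<Delta> E" using assms(3) unfolding building_def by blast
  interpret restricted_universal I \<Delta> E \<Omega> col F F'
  proof
    show "finite P" if "i \<in> I" "P \<in> \<Delta> // E i" for i P
      using assms(4) that unfolding locally_finite_semiregular_def by blast
    show "F i \<subseteq> F' i" if "i \<in> I" for i using assms(9) that by blast
  qed (use assms cs in simp_all)
  obtain x\<^sub>0 where x\<^sub>0: "x\<^sub>0 \<in> \<Delta>" using cs unfolding chamber_system_def by blast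
  have "compactin coset_topology (pointwise_stabilizer (\<U> F) {x\<^sub>0})"
    using compactin_chamber_stabilizer[OF x\<^sub>0 building_connected[OF assms(3) x\<^sub>0]] by simp
  moreover have "pointwise_stabilizer (\<U> F) {x\<^sub>0} \<in> \<N>" using stabilizer_mem[of "{x\<^sub>0}"] x\<^sub>0 by simp
  ultimately have "locally_compact_space coset_topology"
    using locally_compact_coset_topology by blast
  then show ?thesis
    unfolding tdlc_group_def restricted_topology_eq
    using topological_group_coset_topology Hausdorff_coset_topology
      totally_disconnected_coset_topology by blast
qed

end
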